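(* Let $d\ge1$, $\alpha>1$, and let $$S_\alpha:=\Bigl\{s\in[0,\infty)^d:\sum_{j=1}^d s_j^\alpha=1\Bigr\}.$$ Let $F_k$, $k=1,2$, be $d$-dimensional max-stable distribution functions with unit-$\alpha$-Fréchet margins and let $H_k$ be their angular measures on $S_\alpha$, normalised by $\int_{S_\alpha}s_j^\alpha\,H_k(ds)=1$, $j=1,\dots,d$. Then $H_k(S_\alpha)=d$; thus $P_k:=H_k/d$ is a probability measure, and the canonical de Haan representer of $F_k$ is $Z^{(k)*}=d^{1/\alpha}S^{(k)}$ with $S^{(k)}\sim P_k$. Moreover, for $1\le p<\alpha$, $$W_{p,\|\cdot\|_\infty}(F_1,F_2)\le d^{1/\alpha}\,\Gamma\Bigl(1-\frac p\alpha\Bigr)^{1/p}\,W_{\alpha,\|\cdot\|_\infty}(P_1,P_2),$$ and $$W_{p,\|\cdot\|_1}(F_1,F_2)\le d^{1/\alpha}\,\Gamma\Bigl(1-\frac p\alpha\Bigr)^{1/p}\inf_{\pi\in\Pi(P_1,P_2)}\sum_{j=1}^d\left(\int|s_j-t_j|^\alpha\,\pi(ds,dt)\right)^{1/\alpha}.$$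
   Context: $\Gamma(\cdot)$ is the Gamma function. $\|x\|_\infty=\max_j|x_j|$, $\|x\|_1=\sum_j|x_j|$. A $d$-dimensional max-stable distribution function $F$ with unit-$\alpha$-Fréchet margins (each margin is $x\mapsto\exp\{-x^{-\alpha}\}$ for $x>0$) has the form $F(x)=\exp\{-V(x)\}$ for $x\in(0,\infty)^d$ (and $F(x)=0$ if some coordinate is non-positive), where $V(x)=\mathbb{E}\{\max_{1\le j\le d}Z_j^\alpha/x_j^\alpha\}$ for some random vector $Z$ with values in $[0,\infty)^d$ such that $\mathbb{E}\{Z_j^\alpha\}=1$ for all $j$ and $\mathbb{P}\{\max_jZ_j>0\}=1$. Any such $Z$ is called a de Haan representer of $F$. Angular measure on $S_\alpha$: with $\tau_\alpha(z)=(\sum_jz_j^\alpha)^{1/\alpha}$, it is the finite Borel measure $H(B)=\mathbb{E}\{\tau_\alpha(Z)^\alpha\,\mathbb{I}(Z/\tau_\alpha(Z)\in B)\}$, $B\in\mathcal B(S_\alpha)$, for a de Haan representer $Z$ of $F$; it satisfies $V(x)=\int_{S_\alpha}\max_{1\le j\le d}(s_j/x_j)^\alpha H(ds)$ for $x\in(0,\infty)^d$. With $b=H(S_\alpha)$ and $\Theta\sim H/b$, the random vector $b^{1/\alpha}\Theta$ is called the canonical de Haan representer of $F$ associated with $S_\alpha$. Wasserstein distance: for $q\ge1$, a norm $\|\cdot\|$ on $\mathbb{R}^d$ and probability measures $\mu,\nu$ with finite $q$-th moment, $W_{q,\|\cdot\|}(\mu,\nu)=\inf_{\pi\in\Pi(\mu,\nu)}(\int\|x-y\|^q\,\pi(dx,dy))^{1/q}$,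 where $\Pi(\mu,\nu)$ is the set of couplings of $\mu$ and $\nu$. $W_{p,\|\cdot\|}(F_1,F_2)$ denotes the distance between the probability laws with distribution functions $F_1,F_2$. *)

theory Defs
  imports "HOL-Probability.Probability"
begin

text \<open>On \<^typ>\<open>real ^ 'n\<close> the order is componentwise, so \<^term>\<open>{..x}\<close> is the lower orthant below \<^term>\<open>x\<close>.\<close>

definition has_distribution_function ::
    "(real ^ 'n) measure \<Rightarrow> (real ^ 'n \<Rightarrow> real) \<Rightarrow> bool" where
  "has_distribution_function \<mu> F \<longleftrightarrow>
     prob_space \<mu> \<and> sets \<mu> = sets borel \<and> (\<forall>x. measure \<mu> {..x} = F x)"

definition law_of :: "(real ^ 'n \<Rightarrow> real) \<Rightarrow> (real ^ 'n) measure" where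
  "law_of F = (THE \<mu>. has_distribution_function \<mu> F)"

lemma has_distribution_function_unique:
  fixes F :: "real ^ 'n \<Rightarrow> real"
  assumes "has_distribution_function \<mu> F" "has_distribution_function \<nu> F"
  shows "\<mu> = \<nu>"
proof -
  interpret M: prob_space \<mu> using assms by (simp add: has_distribution_function_def)
  interpret N: prob_space \<nu> using assms by (simp add: has_distribution_function_def)
  let ?E = "range (\<lambda>a :: real ^ 'n. {..a})"
  let ?A = "\<lambda>n::nat. {..(\<chi> i. real n) :: real ^ 'n}"
  have gen: "sets (borel :: (real ^ 'n) measure) = sigma_sets UNIV ?E"
    by (subst borel_eq_atMost) (simp add: sets_measure_of)
  have inter: "{..a} \<inter> {..b} = {..(\<chi> i. min (a $ i) (b $ i))}" for a b :: "real ^ 'n"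
    by (auto simp: less_eq_vec_def)
  have stable: "Int_stable ?E"
    by (rule Int_stableI) (auto simp: inter)
  have cover: "(\<Union>n. ?A n) = UNIV"
  proof -
    have "\<exists>n. y \<in> ?A n" for y :: "real ^ 'n"
    proof -
      obtain n :: nat where n: "norm y \<le> real n" using real_arch_simple by blast
      have "y $ i \<le> real n" for i
        using component_le_norm_cart[of y i] n by linarith
      then show ?thesis by (auto simp: less_eq_vec_def)
    qed
    then show ?thesis by auto
  qed
  show ?thesis
  proof (rule measure_eqI_generator_eq[OF stable, of UNIV _ _ ?A])
    show "emeasure \<mu> X = emeasure \<nu> X" if "X \<in> ?E" for X
      using that assms
      by (auto simp: has_distribution_function_def M.emeasure_eq_measure N.emeasure_eq_measure)
  qed (use assms gen cover in \<open>auto simp: has_distribution_function_def\<close>)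
qed

lemma law_of_eq: "has_distribution_function \<mu> F \<Longrightarrow> law_of F = \<mu>"
  unfolding law_of_def by (blast intro: the_equality has_distribution_function_unique)

definition max_stable :: "(real ^ 'n \<Rightarrow> real) \<Rightarrow> bool" where
  "max_stable F \<longleftrightarrow>
     (\<exists>\<mu>. has_distribution_function \<mu> F) \<and>
     (\<forall>m::nat. m \<ge> 1 \<longrightarrow>
        (\<exists>a b :: real ^ 'n. (\<forall>j. a $ j > 0) \<and>
           (\<forall>x. F (\<chi> j. a $ j * x $ j + b $ j) ^ m = F x)))"

definition unit_frechet_margins :: "real \<Rightarrow> (real ^ 'n \<Rightarrow> real) \<Rightarrow> bool" where
  "unit_frechet_margins \<alpha> F \<longleftrightarrow>
     (\<forall>j. \<forall>t>0. measure (law_of F) {y. y $ j \<le> t} = exp (- (t powr (- \<alpha>))))"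

definition de_haan_representer ::
    "real \<Rightarrow> (real ^ 'n \<Rightarrow> real) \<Rightarrow> 'a measure \<Rightarrow> ('a \<Rightarrow> real ^ 'n) \<Rightarrow> bool" where
  "de_haan_representer \<alpha> F M Z \<longleftrightarrow>
     prob_space M \<and> Z \<in> borel_measurable M \<and>
     (\<forall>\<omega>\<in>space M. \<forall>j. 0 \<le> Z \<omega> $ j) \<and>
     (\<forall>j. (\<integral>\<^sup>+ \<omega>. ennreal ((Z \<omega> $ j) powr \<alpha>) \<partial>M) = 1) \<and>
     (AE \<omega> in M. (MAX j. Z \<omega> $ j) > 0) \<and>
     (\<forall>x. (\<forall>j. x $ j > 0) \<longrightarrow>
        F x = exp (- (\<integral>\<omega>. (MAX j. (Z \<omega> $ j) powr \<alpha> / (x $ j) powr \<alpha>) \<partial>M))) \<and>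
     (\<forall>x. (\<exists>j. x $ j \<le> 0) \<longrightarrow> F x = 0)"

definition sphere_pow :: "real \<Rightarrow> (real ^ 'n) set" where
  "sphere_pow \<alpha> = {s. (\<forall>j. 0 \<le> s $ j) \<and> (\<Sum>j\<in>UNIV. (s $ j) powr \<alpha>) = 1}"

definition tau :: "real \<Rightarrow> real ^ 'n \<Rightarrow> real" where
  "tau \<alpha> z = (\<Sum>j\<in>UNIV. (z $ j) powr \<alpha>) powr (1 / \<alpha>)"

text \<open>The angular measure lives on the sphere itself, with the trace of the Borel sets. Taking
  the probability space of the representer to be a measure on \<^typ>\<open>real ^ 'n\<close> loses nothing:
  a representer may be replaced by the identity on \<^typ>\<open>real ^ 'n\<close> under the law of the
  representer, restricted to the nonnegative orthant. Where \<^term>\<open>tau \<alpha> (Z \<omega>) = 0\<close> the integrand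
  vanishes.\<close>

definition angular_measure ::
    "real \<Rightarrow> (real ^ 'n \<Rightarrow> real) \<Rightarrow> (real ^ 'n) measure \<Rightarrow> bool" where
  "angular_measure \<alpha> F H \<longleftrightarrow>
     sets H = sets (restrict_space borel (sphere_pow \<alpha>)) \<and>
     (\<exists>(M :: (real ^ 'n) measure) Z. de_haan_representer \<alpha> F M Z \<and>
        (\<forall>B\<in>sets H. emeasure H B =
           (\<integral>\<^sup>+ \<omega>. ennreal (tau \<alpha> (Z \<omega>) powr \<alpha>) *
              indicator B ((1 / tau \<alpha> (Z \<omega>)) *\<^sub>R Z \<omega>) \<partial>M)))"

definition random_element_with_law ::
    "'a measure \<Rightarrow> ('a \<Rightarrow> 'b) \<Rightarrow> 'b measure \<Rightarrow> bool" where
  "random_element_with_law M X P \<longleftrightarrow>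
     prob_space M \<and> X \<in> measurable M P \<and> distr M P X = P"

definition canonical_de_haan_representer ::
    "real \<Rightarrow> (real ^ 'n) measure \<Rightarrow> 'a measure \<Rightarrow> ('a \<Rightarrow> real ^ 'n) \<Rightarrow> bool" where
  "canonical_de_haan_representer \<alpha> H M Y \<longleftrightarrow>
     (\<exists>\<Theta>. random_element_with_law M \<Theta> (scale_measure (1 / emeasure H (space H)) H) \<and>
        (\<forall>\<omega>\<in>space M. Y \<omega> = (measure H (space H) powr (1 / \<alpha>)) *\<^sub>R \<Theta> \<omega>))"

definition couplings :: "'a measure \<Rightarrow> 'b measure \<Rightarrow> ('a \<times> 'b) measure set" where
  "couplings \<mu> \<nu> =
     {\<pi>. sets \<pi> = sets (\<mu> \<Otimes>\<^sub>M \<nu>) \<and> distr \<pi> \<mu> fst = \<mu> \<and> distr \<pi> \<nu> snd = \<nu>}"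

text \<open>The library has no real power on \<^typ>\<open>ennreal\<close>; this one is for exponents \<^term>\<open>r > 0\<close>.\<close>

definition ennreal_powr :: "ennreal \<Rightarrow> real \<Rightarrow> ennreal" where
  "ennreal_powr x r = (if x = \<top> then \<top> else ennreal (enn2real x powr r))"

text \<open>Valued in \<^typ>\<open>ennreal\<close>, so that no moment condition is needed to make sense of it.\<close>

definition wasserstein ::
    "real \<Rightarrow> (real ^ 'n \<Rightarrow> real) \<Rightarrow> (real ^ 'n) measure \<Rightarrow> (real ^ 'n) measure \<Rightarrow> ennreal" where
  "wasserstein q N \<mu> \<nu> =
     (INF \<pi>\<in>couplings \<mu> \<nu>. ennreal_powr (\<integral>\<^sup>+ (x, y). ennreal (N (x - y) powr q) \<partial>\<pi>) (1 / q))"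

text \<open>The maximum norm is the library's \<^const>\<open>infnorm\<close>.\<close>

definition l1norm :: "real ^ 'n \<Rightarrow> real" where
  "l1norm x = (\<Sum>j\<in>UNIV. \<bar>x $ j\<bar>)"

end

theory Submission
  imports Defs
begin

text \<open>The proof couples the two max-stable laws through one Poisson process. Let \<open>\<pi>\<close> be a coupling of
  the two normalised angular measures. Then \<open>Z1 = d powr (1 / \<alpha>) *\<^sub>R s\<close> and
  \<open>Z2 = d powr (1 / \<alpha>) *\<^sub>R t\<close>, with \<open>(s, t)\<close> distributed according to \<open>\<pi>\<close> and \<open>d = CARD('n)\<close>, are
  de Haan representers of the two distribution functions on a common probability space
  (\<open>de_haan_representer_angular\<close>). Take a Poisson process of points \<open>v > 0\<close> with unit intensity, each
  carrying an independent mark \<open>(s, t)\<close> with law \<open>\<pi>\<close>. The coordinatewise suprema \<open>X\<close> and \<open>Y\<close> of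
  \<open>v powr (- 1 / \<alpha>) *\<^sub>R Z1\<close> and of \<open>v powr (- 1 / \<alpha>) *\<^sub>R Z2\<close> over all points then have the two given
  laws, because the event that a vector of suprema stays below a level says that a region contains
  no point of the process (\<open>poisson_void\<close>, \<open>has_distribution_function_max_stable_vector\<close>).

  Since a difference of suprema is at most the supremum of the differences, \<open>infnorm (X - Y)\<close> is at
  most the supremum of \<open>v powr (- 1 / \<alpha>) * infnorm (Z1 - Z2)\<close>. This is a Frechet variable whose
  \<open>p\<close>-th moment is \<open>Gamma (1 - p / \<alpha>)\<close> times the power \<open>p / \<alpha>\<close> of the integral of
  \<open>infnorm (Z1 - Z2) powr \<alpha>\<close> (\<open>frechet_sup_moment\<close>), which is the first bound. The second
  one follows in the same way, coordinate by coordinate, with Minkowski's inequality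
  (\<open>nn_integral_powr_sum_le\<close>) to sum the coordinates.

  The Poisson process is built from independent unit blocks: block \<open>k\<close> has a Poisson number, with mean
  1, of points distributed uniformly on \<open>{k<..k + 1}\<close>.\<close>

section \<open>Inequalities and measurability\<close>

lemma convex_on_powr_nonneg:
  fixes p :: real
  assumes "1 \<le> p" shows "convex_on {0..} (\<lambda>x. x powr p)"
  unfolding convex_on_def
proof (intro conjI ballI allI impI)
  fix x y u v :: real
  assume xy: "x \<in> {0..}" "y \<in> {0..}" and uv: "0 \<le> u" "0 \<le> v" "u + v = 1"
  have scale: "(w * z) powr p \<le> w * z powr p" if "0 \<le> w" "w \<le> 1" "0 \<le> z" for w z :: real
  proof -
    have "w powr p \<le> w powr 1"
      using that assms by (intro powr_mono') auto
    then show ?thesis using that by (simp add: powr_mult mult_right_mono)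
  qed
  show "(u *\<^sub>R x + v *\<^sub>R y) powr p \<le> u * x powr p + v * y powr p"
  proof (cases "x = 0 \<or> y = 0")
    case True
    then show ?thesis using scale[of u x] scale[of v y] xy uv assms by auto
  next
    case False
    then have "x \<in> {0<..}" "y \<in> {0<..}" using xy by auto
    then show ?thesis using powr_convex[OF assms] uv unfolding convex_on_def by blast
  qed
qed simp

text \<open>Minkowski's inequality for a finite sum, in terms of upper bounds \<open>A j\<close> for the \<open>p\<close>-norms. With
  \<open>a\<close> the sum of the \<open>A j\<close>, it is convexity of the \<open>p\<close>-th power applied to the mean, with weights
  \<open>A j / a\<close>, of the normalised functions \<open>a * f j / A j\<close>.\<close>

lemma nn_integral_powr_sum_le:
  fixes f :: "'i \<Rightarrow> 'a \<Rightarrow> real"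
  assumes J: "finite J" and p: "1 \<le> p"
    and f [measurable]: "\<And>j. j \<in> J \<Longrightarrow> f j \<in> borel_measurable M"
    and f0: "\<And>j \<omega>. j \<in> J \<Longrightarrow> 0 \<le> f j \<omega>"
    and A: "\<And>j. j \<in> J \<Longrightarrow> 0 \<le> A j"
    and fA: "\<And>j. j \<in> J \<Longrightarrow> (\<integral>\<^sup>+ \<omega>. ennreal (f j \<omega> powr p) \<partial>M) \<le> ennreal (A j powr p)"
  shows "(\<integral>\<^sup>+ \<omega>. ennreal ((\<Sum>j\<in>J. f j \<omega>) powr p) \<partial>M) \<le> ennreal ((\<Sum>j\<in>J. A j) powr p)"
proof -
  \<comment> \<open>Indices with \<open>A j = 0\<close> cannot be normalised, but there \<open>f j\<close> vanishes almost everywhere.\<close>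
  define K where "K = {j \<in> J. 0 < A j}"
  define a where "a = (\<Sum>j\<in>K. A j)"
  have K: "finite K" "K \<subseteq> J" using J by (auto simp: K_def)
  have sumA: "(\<Sum>j\<in>J. A j) = a"
    unfolding a_def using K A by (intro sum.mono_neutral_right J) (force simp: K_def)+
  have "AE \<omega> in M. \<forall>j\<in>J - K. f j \<omega> = 0"
  proof (rule AE_finite_allI)
    fix j assume j: "j \<in> J - K"
    then have "A j = 0" using A by (force simp: K_def)
    then have "(\<integral>\<^sup>+ \<omega>. ennreal (f j \<omega> powr p) \<partial>M) = 0" using fA[of j] j by auto
    then have "AE \<omega> in M. ennreal (f j \<omega> powr p) = 0"
      using j by (subst (asm) nn_integral_0_iff_AE) auto
    then show "AE \<omega> in M. f j \<omega> = 0" by eventually_elim auto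
  qed (use J in auto)
  then have sumf: "AE \<omega> in M. (\<Sum>j\<in>J. f j \<omega>) = (\<Sum>j\<in>K. f j \<omega>)"
    by eventually_elim (use J K in \<open>auto intro!: sum.mono_neutral_right\<close>)
  show ?thesis
  proof (cases "K = {}")
    case True
    then have "AE \<omega> in M. ennreal ((\<Sum>j\<in>J. f j \<omega>) powr p) = 0" using sumf by auto
    then have "(\<integral>\<^sup>+ \<omega>. ennreal ((\<Sum>j\<in>J. f j \<omega>) powr p) \<partial>M) = 0"
      by (subst nn_integral_cong_AE) auto
    then show ?thesis by simp
  next
    case False
    have Apos: "0 < A j" if "j \<in> K" for j using that by (simp add: K_def)
    have a: "0 < a" unfolding a_def using K(1) False Apos by (rule sum_pos)
    let ?w = "\<lambda>j. a powr (p - 1) * A j powr (1 - p)"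
    have pw: "(\<Sum>j\<in>K. f j \<omega>) powr p \<le> (\<Sum>j\<in>K. ?w j * f j \<omega> powr p)" for \<omega>
    proof -
      have "(\<Sum>j\<in>K. (A j / a) *\<^sub>R (a * (f j \<omega> / A j))) powr p \<le>
          (\<Sum>j\<in>K. (A j / a) * (a * (f j \<omega> / A j)) powr p)"
        using f0 K a Apos False
        by (intro convex_on_sum[OF _ _ convex_on_powr_nonneg[OF p]])
          (auto simp: sum_divide_distrib[symmetric] a_def less_imp_le
             intro!: divide_nonneg_nonneg mult_nonneg_nonneg)
      also have "(\<Sum>j\<in>K. (A j / a) *\<^sub>R (a * (f j \<omega> / A j))) = (\<Sum>j\<in>K. f j \<omega>)"
        using a Apos by (intro sum.cong) (simp_all add: less_imp_neq[THEN not_sym])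
      also have "(\<Sum>j\<in>K. (A j / a) * (a * (f j \<omega> / A j)) powr p) = (\<Sum>j\<in>K. ?w j * f j \<omega> powr p)"
      proof (rule sum.cong)
        fix j assume j: "j \<in> K"
        have "f j \<omega> \<ge> 0" using f0 j K by auto
        then show "(A j / a) * (a * (f j \<omega> / A j)) powr p = ?w j * f j \<omega> powr p"
          using a Apos[OF j] by (simp add: powr_mult powr_divide powr_diff field_simps)
      qed simp
      finally show ?thesis .
    qed
    have "(\<integral>\<^sup>+ \<omega>. ennreal ((\<Sum>j\<in>J. f j \<omega>) powr p) \<partial>M) =
        (\<integral>\<^sup>+ \<omega>. ennreal ((\<Sum>j\<in>K. f j \<omega>) powr p) \<partial>M)"
      using sumf by (intro nn_integral_cong_AE) auto
    also have "\<dots> \<le> (\<integral>\<^sup>+ \<omega>. (\<Sum>j\<in>K. ennreal (?w j) * ennreal (f j \<omega> powr p)) \<partial>M)"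
    proof (rule nn_integral_mono)
      fix \<omega>
      have "(\<Sum>j\<in>K. ennreal (?w j) * ennreal (f j \<omega> powr p)) =
          ennreal (\<Sum>j\<in>K. ?w j * f j \<omega> powr p)"
        by (subst sum_ennreal[symmetric]) (simp_all add: ennreal_mult')
      then show "ennreal ((\<Sum>j\<in>K. f j \<omega>) powr p) \<le>
          (\<Sum>j\<in>K. ennreal (?w j) * ennreal (f j \<omega> powr p))"
        using ennreal_leI[OF pw[of \<omega>]] by (simp only:)
    qed
    also have "\<dots> = (\<Sum>j\<in>K. ennreal (?w j) * (\<integral>\<^sup>+ \<omega>. ennreal (f j \<omega> powr p) \<partial>M))"
    proof (subst nn_integral_sum)
      have [measurable]: "f j \<in> borel_measurable M" if "j \<in> K" for j using f that K by blast
      show "(\<lambda>\<omega>. ennreal (?w j) * ennreal (f j \<omega> powr p)) \<in> borel_measurable M" if "j \<in> K" for j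
        using that by measurable
      show "(\<Sum>j\<in>K. \<integral>\<^sup>+ \<omega>. ennreal (?w j) * ennreal (f j \<omega> powr p) \<partial>M) =
          (\<Sum>j\<in>K. ennreal (?w j) * (\<integral>\<^sup>+ \<omega>. ennreal (f j \<omega> powr p) \<partial>M))"
      proof (rule sum.cong[OF refl])
        show "(\<integral>\<^sup>+ \<omega>. ennreal (?w j) * ennreal (f j \<omega> powr p) \<partial>M) =
            ennreal (?w j) * (\<integral>\<^sup>+ \<omega>. ennreal (f j \<omega> powr p) \<partial>M)" if "j \<in> K" for j
          using that by (intro nn_integral_cmult) measurable
      qed
    qed
    also have "\<dots> \<le> (\<Sum>j\<in>K. ennreal (?w j) * ennreal (A j powr p))"
      using K fA by (intro sum_mono mult_left_mono) auto
    also have "\<dots> = ennreal (\<Sum>j\<in>K. ?w j * A j powr p)"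
      by (subst sum_ennreal[symmetric]) (simp_all add: ennreal_mult')
    also have "(\<Sum>j\<in>K. ?w j * A j powr p) = (\<Sum>j\<in>K. a powr (p - 1) * A j)"
      using Apos by (intro sum.cong) (simp_all add: mult.assoc powr_add[symmetric] abs_of_pos)
    also have "\<dots> = a powr (p - 1) * a"
      by (simp only: sum_distrib_left[symmetric] a_def[symmetric])
    also have "\<dots> = a powr p" using a by (simp add: powr_diff)
    finally show ?thesis unfolding sumA .
  qed
qed

lemma borel_measurable_vec_nth [measurable]:
  "(\<lambda>x :: real ^ 'n. x $ j) \<in> borel_measurable borel"
  by (intro borel_measurable_continuous_onI continuous_intros)

lemma borel_measurable_vec_lambda:
  fixes X :: "'n::finite \<Rightarrow> 'a \<Rightarrow> real"
  assumes "\<And>j. X j \<in> borel_measurable M"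
  shows "(\<lambda>\<omega>. \<chi> j. X j \<omega>) \<in> borel_measurable M"
  using assms by (subst borel_measurable_euclidean_space) (auto simp: Basis_vec_def inner_axis)

lemma borel_measurable_infnorm [measurable]:
  "(infnorm :: real ^ 'n \<Rightarrow> real) \<in> borel_measurable borel"
  by (intro borel_measurable_continuous_onI continuous_intros)

lemma borel_measurable_l1norm [measurable]:
  "(l1norm :: real ^ 'n \<Rightarrow> real) \<in> borel_measurable borel"
  unfolding l1norm_def[abs_def] by measurable

lemma infnorm_le_cart:
  fixes x :: "real ^ 'n"
  assumes "\<And>j. \<bar>x $ j\<bar> \<le> r" shows "infnorm x \<le> r"
  unfolding infnorm_cart using assms by (intro cSup_least) auto

lemma ennreal_powr_mono: "x \<le> y \<Longrightarrow> 0 \<le> r \<Longrightarrow> ennreal_powr x r \<le> ennreal_powr y r"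
  unfolding ennreal_powr_def
  by (auto simp: top_unique intro!: ennreal_leI powr_mono2 enn2real_mono simp: less_top)

lemma ennreal_powr_ennreal: "0 \<le> a \<Longrightarrow> ennreal_powr (ennreal a) r = ennreal (a powr r)"
  by (simp add: ennreal_powr_def)

lemma ennreal_powr_mult_const:
  assumes "0 \<le> c"
  shows "ennreal_powr (ennreal c * x) r \<le> ennreal (c powr r) * ennreal_powr x r"
proof (cases "x = \<top>")
  case True
  then show ?thesis
    by (cases "c = 0") (use assms in \<open>auto simp: ennreal_powr_def ennreal_mult_top\<close>)
next
  case False
  then obtain y where "x = ennreal y" "0 \<le> y" by (cases x) auto
  then show ?thesis
    using assms by (simp add: ennreal_mult[symmetric] ennreal_powr_ennreal powr_mult)
qed

lemma Max_cmult:
  fixes f :: "'i::finite \<Rightarrow> real"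
  assumes "0 \<le> c" shows "(MAX j. c * f j) = c * (MAX j. f j)"
proof -
  have "mono (\<lambda>x. c * x)" using assms by (auto intro!: monoI mult_left_mono)
  from mono_Max_commute[OF this, of "range f"] show ?thesis by (simp add: image_image)
qed

lemma inverse_of_nat_mult_ennreal:
  assumes "0 < d" shows "1 / of_nat d * (of_nat d :: ennreal) = 1"
proof -
  have "1 / (of_nat d :: ennreal) = ennreal (1 / real d)"
    using divide_ennreal[of 1 "real d"] assms by (simp add: ennreal_of_nat_eq_real_of_nat)
  then show ?thesis
    using assms by (simp add: ennreal_of_nat_eq_real_of_nat ennreal_mult[symmetric])
qed

lemma ennreal_mult_le_INF:
  fixes c :: real and f :: "'a \<Rightarrow> ennreal"
  assumes "0 < c" "\<And>x. x \<in> A \<Longrightarrow> w \<le> ennreal c * f x"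
  shows "w \<le> ennreal c * (INF x\<in>A. f x)"
proof -
  have inv: "ennreal c * ennreal (1 / c) = 1"
    using assms(1) by (simp add: ennreal_mult[symmetric])
  have "ennreal (1 / c) * w \<le> f x" if "x \<in> A" for x
  proof -
    have "ennreal (1 / c) * w \<le> ennreal (1 / c) * (ennreal c * f x)"
      using assms(2)[OF that] by (rule mult_left_mono) simp
    also have "\<dots> = f x" using inv by (simp add: mult.assoc[symmetric] mult.commute)
    finally show ?thesis .
  qed
  then have "ennreal c * (ennreal (1 / c) * w) \<le> ennreal c * (INF x\<in>A. f x)"
    by (intro mult_left_mono INF_greatest) auto
  then show ?thesis using inv by (simp add: mult.assoc[symmetric])
qed

section \<open>A Poisson process with marks\<close>

text \<open>The uniform distribution on the unit interval. The point 0 is left out because 0 to a negative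
  power is 0, not infinity.\<close>

definition unit_interval :: "real measure" where
  "unit_interval = restrict_space lborel {0<..1}"

text \<open>A random number \<open>n\<close>, Poisson distributed with mean 1, and an independent sequence of independent
  pairs of a uniform variable and a mark with law \<open>T\<close>. The block stands for its first \<open>n\<close> pairs;
  the later ones are ignored.\<close>

definition poisson_block :: "'a measure \<Rightarrow> (nat \<times> (nat \<Rightarrow> real \<times> 'a)) measure" where
  "poisson_block T = measure_pmf (poisson_pmf 1) \<Otimes>\<^sub>M (\<Pi>\<^sub>M i\<in>UNIV. unit_interval \<Otimes>\<^sub>M T)"

text \<open>Independent blocks, the \<open>k\<close>-th one translated by \<open>k\<close>: the points \<open>k + u\<close> with their marks form a
  Poisson process on the positive half-line times the space of marks, with intensity Lebesgue
  measure times \<open>T\<close>. The translation is not part of the space; it is made wherever the points are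
  used.\<close>

definition poisson_space :: "'a measure \<Rightarrow> (nat \<Rightarrow> nat \<times> (nat \<Rightarrow> real \<times> 'a)) measure" where
  "poisson_space T = (\<Pi>\<^sub>M k\<in>UNIV. poisson_block T)"

lemma space_unit_interval [simp]: "space unit_interval = {0<..1}"
  by (simp add: unit_interval_def space_restrict_space)

lemma prob_space_unit_interval: "prob_space unit_interval"
proof
  have "emeasure unit_interval {0<..1} = 1"
    unfolding unit_interval_def by (subst emeasure_restrict_space) auto
  then show "emeasure unit_interval (space unit_interval) = 1" by simp
qed

lemma measurable_unit_interval: "(\<lambda>u. u) \<in> borel_measurable unit_interval"
  unfolding unit_interval_def by (rule measurable_restrict_space1) simp

lemma prob_space_poisson_block:
  assumes "prob_space T" shows "prob_space (poisson_block T)"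
proof -
  interpret Q: pair_prob_space unit_interval T
    using assms prob_space_unit_interval by (simp add: pair_prob_space_def pair_sigma_finite_def prob_space_imp_sigma_finite)
  interpret S: prob_space "\<Pi>\<^sub>M i\<in>UNIV. unit_interval \<Otimes>\<^sub>M T"
    by (rule prob_space_PiM) (rule Q.prob_space_axioms)
  interpret B: pair_prob_space "measure_pmf (poisson_pmf 1)" "\<Pi>\<^sub>M i\<in>UNIV. unit_interval \<Otimes>\<^sub>M T" ..
  show ?thesis unfolding poisson_block_def by (rule B.P.prob_space_axioms)
qed

lemma prob_space_poisson_space:
  assumes "prob_space T" shows "prob_space (poisson_space T)"
  unfolding poisson_space_def using prob_space_poisson_block[OF assms] by (intro prob_space_PiM) 

lemma emeasure_unit_interval_less:
  "emeasure unit_interval {u \<in> {0<..1}. u < c} = ennreal (min 1 (max 0 c))"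
proof -
  have "{u \<in> {0<..1}. u < c} = (if c > 1 then {0<..1} else {0<..<c})" by auto
  moreover have "emeasure unit_interval {u \<in> {0<..1}. u < c} = emeasure lborel {u \<in> {0<..1}. u < c}"
    unfolding unit_interval_def by (subst emeasure_restrict_space) auto
  ultimately show ?thesis by (auto simp: min_def max_def ennreal_neg)
qed

text \<open>A Poisson(1) number of independent points all fall into \<open>A\<close> with probability
  \<open>exp (- (1 - q))\<close>, where \<open>q\<close> is the probability of \<open>A\<close>: the generating function of the
  Poisson distribution at \<open>q\<close>.\<close>

lemma poisson_block_void:
  assumes T: "prob_space T" and A: "A \<in> sets (unit_interval \<Otimes>\<^sub>M T)"
  shows "measure (poisson_block T) {w \<in> space (poisson_block T). \<forall>i<fst w. snd w i \<in> A} =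
    exp (- (1 - measure (unit_interval \<Otimes>\<^sub>M T) A))"
    and "{w \<in> space (poisson_block T). \<forall>i<fst w. snd w i \<in> A} \<in> sets (poisson_block T)"
proof -
  let ?Q = "unit_interval \<Otimes>\<^sub>M T"
  interpret Q: pair_prob_space unit_interval T
    using T prob_space_unit_interval by (simp add: pair_prob_space_def pair_sigma_finite_def prob_space_imp_sigma_finite)
  interpret S: sequence_space ?Q ..
  interpret S': prob_space "\<Pi>\<^sub>M i\<in>UNIV. ?Q"
    by (rule prob_space_PiM) (rule Q.prob_space_axioms)
  interpret B: pair_prob_space "measure_pmf (poisson_pmf 1)" "\<Pi>\<^sub>M i\<in>UNIV. ?Q" ..
  interpret B': prob_space "poisson_block T" by (rule prob_space_poisson_block[OF T])
  let ?B = "{w \<in> space (poisson_block T). \<forall>i<fst w. snd w i \<in> A}"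
  note [measurable] = A
  have "{w \<in> space (poisson_block T). \<forall>i. i < fst w \<longrightarrow> snd w i \<in> A} \<in> sets (poisson_block T)"
    unfolding poisson_block_def by measurable
  then show B: "?B \<in> sets (poisson_block T)" by simp
  let ?a = "measure ?Q A"
  have slice: "emeasure (\<Pi>\<^sub>M i\<in>UNIV. ?Q) (Pair n -` ?B) = ennreal (?a ^ n)" for n
  proof -
    have "Pair n -` ?B = {x \<in> space (\<Pi>\<^sub>M i\<in>UNIV. ?Q). \<forall>i\<in>{..<n}. x i \<in> A}"
      by (auto simp: poisson_block_def space_pair_measure)
    also have "emeasure (\<Pi>\<^sub>M i\<in>UNIV. ?Q) \<dots> = (\<Prod>i<n. emeasure ?Q A)"
      by (rule S.emeasure_PiM_Collect) auto
    finally show ?thesis by (simp add: Q.emeasure_eq_measure ennreal_power)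
  qed
  have "emeasure (poisson_block T) ?B =
      (\<integral>\<^sup>+ n. emeasure (\<Pi>\<^sub>M i\<in>UNIV. ?Q) (Pair n -` ?B) \<partial>measure_pmf (poisson_pmf 1))"
    using B unfolding poisson_block_def by (rule S'.emeasure_pair_measure_alt)
  also have "\<dots> = (\<Sum>n. ennreal (?a ^ n / fact n * exp (- 1)))"
    unfolding slice nn_integral_measure_pmf nn_integral_count_space_nat
    by (intro suminf_cong) (simp add: ennreal_mult'[symmetric] mult_ac)
  also have "\<dots> = ennreal (exp ?a * exp (- 1))"
  proof (rule suminf_ennreal_eq)
    show "(\<lambda>n. ?a ^ n / fact n * exp (- 1)) sums (exp ?a * exp (- 1))"
      using exp_converges[of ?a] by (intro sums_mult2) (simp add: field_simps)
  qed simp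
  finally show "measure (poisson_block T) ?B = exp (- (1 - ?a))"
    by (simp add: B'.emeasure_eq_measure exp_add[symmetric])
qed

text \<open>The probability that the process has no point in the region below the graph of \<open>g\<close>, whose
  intensity is the integral of \<open>g\<close>.\<close>

lemma poisson_void:
  assumes T: "prob_space T" and g: "integrable T g" and g0: "\<And>t. t \<in> space T \<Longrightarrow> 0 \<le> g t"
  shows "measure (poisson_space T)
    {\<omega> \<in> space (poisson_space T). \<forall>k. \<forall>i<fst (\<omega> k).
       g (snd (snd (\<omega> k) i)) \<le> real k + fst (snd (\<omega> k) i)} = exp (- (\<integral>t. g t \<partial>T))"
proof -
  let ?Q = "unit_interval \<Otimes>\<^sub>M T"
  interpret T: prob_space T by fact
  interpret U: prob_space unit_interval by (rule prob_space_unit_interval)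
  interpret Q: pair_prob_space unit_interval T ..
  interpret B: prob_space "poisson_block T" by (rule prob_space_poisson_block[OF T])
  interpret S: sequence_space "poisson_block T" ..
  have [measurable]: "fst \<in> borel_measurable ?Q"
    by (rule measurable_compose[OF measurable_fst measurable_unit_interval])
  have [measurable]: "g \<in> borel_measurable T" using g by auto
  define A where "A k = {q \<in> space ?Q. g (snd q) \<le> real k + fst q}" for k :: nat
  define B where "B k = {w \<in> space (poisson_block T). \<forall>i<fst w. snd w i \<in> A k}" for k
  have A[measurable]: "A k \<in> sets ?Q" for k unfolding A_def by measurable
  have B: "B k \<in> sets (poisson_block T)"
    "measure (poisson_block T) (B k) = exp (- (1 - measure ?Q (A k)))" for k
    using poisson_block_void[OF T A] by (auto simp: B_def)
  \<comment> \<open>The length of the part of \<open>{k<..k + 1}\<close> that lies below \<open>g t\<close>.\<close>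
  define h where "h k t = min 1 (max 0 (g t - real k))" for k :: nat and t
  have [measurable]: "h k \<in> borel_measurable T" for k unfolding h_def by measurable
  have h: "integrable T (h k)" for k
    by (rule T.integrable_const_bound[of _ 1]) (auto simp: h_def)
  have mA: "1 - measure ?Q (A k) = (\<integral>t. h k t \<partial>T)" for k
  proof -
    have "1 - measure ?Q (A k) = measure ?Q (space ?Q - A k)"
      by (simp add: Q.prob_compl)
    also have "\<dots> = enn2real (\<integral>\<^sup>+ t. emeasure unit_interval ((\<lambda>u. (u, t)) -` (space ?Q - A k)) \<partial>T)"
      unfolding measure_def by (subst Q.emeasure_pair_measure_alt2) auto
    also have "(\<integral>\<^sup>+ t. emeasure unit_interval ((\<lambda>u. (u, t)) -` (space ?Q - A k)) \<partial>T) =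
       (\<integral>\<^sup>+ t. ennreal (h k t) \<partial>T)"
    proof (rule nn_integral_cong)
      fix t assume t: "t \<in> space T"
      then have "(\<lambda>u. (u, t)) -` (space ?Q - A k) = {u \<in> {0<..1}. u < g t - real k}"
        by (auto simp: A_def space_pair_measure)
      then show "emeasure unit_interval ((\<lambda>u. (u, t)) -` (space ?Q - A k)) = ennreal (h k t)"
        by (simp only: emeasure_unit_interval_less h_def)
    qed
    also have "enn2real \<dots> = (\<integral>t. h k t \<partial>T)"
      by (rule integral_eq_nn_integral[symmetric]) (auto simp: h_def)
    finally show ?thesis .
  qed
  have hsum: "(\<Sum>k\<le>n. h k t) = min (g t) (real (Suc n))" if "t \<in> space T" for n t
  proof (induction n)
    case 0 then show ?case using g0[OF that] by (auto simp: h_def)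
  next
    case (Suc n)
    have "(\<Sum>k\<le>Suc n. h k t) = min (g t) (real (Suc n)) + h (Suc n) t" by (simp add: Suc)
    then show ?case using g0[OF that] by (auto simp: h_def)
  qed
  have "(\<lambda>n. \<integral>t. min (g t) (real (Suc n)) \<partial>T) \<longlonglongrightarrow> (\<integral>t. g t \<partial>T)"
  proof (rule integral_dominated_convergence[where w = g])
    show "AE t in T. (\<lambda>n. min (g t) (real (Suc n))) \<longlonglongrightarrow> g t"
    proof (rule AE_I2)
      fix t
      have "eventually (\<lambda>n. min (g t) (real (Suc n)) = g t) sequentially"
        using eventually_ge_at_top[of "nat \<lceil>g t\<rceil>"] by eventually_elim (auto simp: min_def)
      then show "(\<lambda>n. min (g t) (real (Suc n))) \<longlonglongrightarrow> g t"
        by (rule tendsto_eventually)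
    qed
    show "AE t in T. norm (min (g t) (real (Suc n))) \<le> g t" for n
      using g0 by (intro AE_I2) auto
  qed (use g in auto)
  moreover have "(\<integral>t. min (g t) (real (Suc n)) \<partial>T) = (\<Sum>k\<le>n. \<integral>t. h k t \<partial>T)" for n
    by (subst Bochner_Integration.integral_sum[symmetric])
      (auto intro!: Bochner_Integration.integral_cong h simp: hsum)
  ultimately have "(\<lambda>n. exp (- (\<Sum>k\<le>n. \<integral>t. h k t \<partial>T))) \<longlonglongrightarrow> exp (- (\<integral>t. g t \<partial>T))"
    by (intro tendsto_intros) simp
  moreover have "(\<Prod>k\<le>n. measure (poisson_block T) (B k)) = exp (- (\<Sum>k\<le>n. \<integral>t. h k t \<partial>T))" for n
    by (simp add: B mA exp_sum sum_negf[symmetric])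
  ultimately have "measure (poisson_space T) (Pi UNIV B) = exp (- (\<integral>t. g t \<partial>T))"
    using LIMSEQ_unique[OF S.measure_PiM_countable[of B]] B(1)
    unfolding poisson_space_def by simp
  moreover have "Pi UNIV B = {\<omega> \<in> space (poisson_space T). \<forall>k. \<forall>i<fst (\<omega> k).
       g (snd (snd (\<omega> k) i)) \<le> real k + fst (snd (\<omega> k) i)}"
  proof -
    have "snd w i \<in> space ?Q" if "w \<in> space (poisson_block T)" for w i
      using that by (auto simp: poisson_block_def space_pair_measure space_PiM PiE_iff)
    then have "w \<in> B k \<longleftrightarrow> w \<in> space (poisson_block T) \<and>
        (\<forall>i<fst w. g (snd (snd w i)) \<le> real k + fst (snd w i))" for w k
      unfolding B_def A_def by blast
    moreover have "\<omega> \<in> space (poisson_space T) \<longleftrightarrow> (\<forall>k. \<omega> k \<in> space (poisson_block T))" for \<omega>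
      by (simp add: poisson_space_def space_PiM PiE_iff)
    ultimately show ?thesis
      by (simp add: Pi_iff set_eq_iff) blast
  qed
  ultimately show ?thesis by simp
qed

section \<open>Suprema of spectral functions over the process\<close>

text \<open>The supremum, over the points \<open>v\<close> of the process with their marks \<open>t\<close>, of
  \<open>v powr (- 1 / \<alpha>) * f t\<close>. Valued in \<^typ>\<open>ennreal\<close>, so that no boundedness is required; terms
  that are not points of the process, and negative values of \<open>f\<close>, count as 0.\<close>

definition frechet_sup ::
    "real \<Rightarrow> ('a \<Rightarrow> real) \<Rightarrow> (nat \<Rightarrow> nat \<times> (nat \<Rightarrow> real \<times> 'a)) \<Rightarrow> ennreal" where
  "frechet_sup \<alpha> f \<omega> = (SUP k. SUP i. if i < fst (\<omega> k)
     then ennreal ((real k + fst (snd (\<omega> k) i)) powr (- 1 / \<alpha>) * f (snd (snd (\<omega> k) i))) else 0)"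

lemma space_poisson_spaceD:
  assumes "\<omega> \<in> space (poisson_space T)"
  shows "0 < fst (snd (\<omega> k) i)" "snd (snd (\<omega> k) i) \<in> space T"
proof -
  have "\<omega> k \<in> space (poisson_block T)"
    using assms by (auto simp: poisson_space_def space_PiM PiE_iff)
  then have "snd (\<omega> k) i \<in> space (unit_interval \<Otimes>\<^sub>M T)"
    by (auto simp: poisson_block_def space_pair_measure space_PiM PiE_iff)
  then show "0 < fst (snd (\<omega> k) i)" "snd (snd (\<omega> k) i) \<in> space T"
    by (auto simp: space_pair_measure)
qed

lemma measurable_frechet_sup [measurable]:
  assumes [measurable]: "f \<in> borel_measurable T"
  shows "frechet_sup \<alpha> f \<in> borel_measurable (poisson_space T)"
proof -
  have block [measurable]: "(\<lambda>\<omega>. \<omega> k) \<in> measurable (poisson_space T) (poisson_block T)" for k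
    unfolding poisson_space_def by measurable
  have [measurable]: "(\<lambda>\<omega>. fst (\<omega> k)) \<in> measurable (poisson_space T) (count_space UNIV)" for k
    by (rule measurable_compose[OF block]) (simp add: poisson_block_def)
  have [measurable]: "(\<lambda>\<omega>. snd (\<omega> k) i) \<in> measurable (poisson_space T) (unit_interval \<Otimes>\<^sub>M T)" for k i
    by (rule measurable_compose[OF block]) (simp add: poisson_block_def)
  have [measurable]: "fst \<in> borel_measurable (unit_interval \<Otimes>\<^sub>M T)"
    by (rule measurable_compose[OF measurable_fst measurable_unit_interval])
  show ?thesis unfolding frechet_sup_def by measurable
qed

lemma frechet_sup_le_iff:
  assumes "0 \<le> x"
  shows "frechet_sup \<alpha> f \<omega> \<le> ennreal x \<longleftrightarrow>
    (\<forall>k. \<forall>i<fst (\<omega> k). (real k + fst (snd (\<omega> k) i)) powr (- 1 / \<alpha>) * f (snd (snd (\<omega> k) i)) \<le> x)"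
  unfolding frechet_sup_def SUP_le_iff using assms
  by (auto simp: ennreal_le_iff2 split: if_splits)

lemma powr_inverse_mult_le_iff:
  fixes v f x \<alpha> :: real
  assumes "0 < v" "0 \<le> f" "0 < x" "0 < \<alpha>"
  shows "v powr (- 1 / \<alpha>) * f \<le> x \<longleftrightarrow> f powr \<alpha> / x powr \<alpha> \<le> v"
proof -
  have "v powr (- 1 / \<alpha>) * f \<le> x \<longleftrightarrow> f \<le> x * v powr (1 / \<alpha>)"
    using assms by (simp add: powr_minus field_simps)
  also have "\<dots> \<longleftrightarrow> f powr \<alpha> \<le> (x * v powr (1 / \<alpha>)) powr \<alpha>"
    using assms by (metis mult_nonneg_nonneg powr_ge_zero powr_less_mono2 powr_mono2 less_imp_le not_le)
  also have "\<dots> \<longleftrightarrow> f powr \<alpha> / x powr \<alpha> \<le> v"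
    using assms by (simp add: powr_mult powr_powr field_simps)
  finally show ?thesis .
qed

text \<open>A bound on the supremum says that the process has no point below the graph of
  \<open>(f t / x) powr \<alpha>\<close>; this turns joint distribution functions into void probabilities.\<close>

lemma frechet_sup_le_iff_powr:
  assumes "\<omega> \<in> space (poisson_space T)" "0 < x" "0 < \<alpha>" "\<And>t. t \<in> space T \<Longrightarrow> 0 \<le> f t"
  shows "frechet_sup \<alpha> f \<omega> \<le> ennreal x \<longleftrightarrow>
    (\<forall>k. \<forall>i<fst (\<omega> k). f (snd (snd (\<omega> k) i)) powr \<alpha> / x powr \<alpha> \<le> real k + fst (snd (\<omega> k) i))"
proof -
  have "0 < real k + fst (snd (\<omega> k) i)" for k i
    using space_poisson_spaceD(1)[OF assms(1), of k i] by linarith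
  then have "(real k + fst (snd (\<omega> k) i)) powr (- 1 / \<alpha>) * f (snd (snd (\<omega> k) i)) \<le> x \<longleftrightarrow>
      f (snd (snd (\<omega> k) i)) powr \<alpha> / x powr \<alpha> \<le> real k + fst (snd (\<omega> k) i)" for k i
    using assms(2-) space_poisson_spaceD(2)[OF assms(1)] by (intro powr_inverse_mult_le_iff) auto
  then show ?thesis
    using assms(2) by (simp only: frechet_sup_le_iff less_imp_le)
qed

lemma integrable_Max:
  fixes f :: "'i \<Rightarrow> 'a \<Rightarrow> real"
  assumes "finite J" "J \<noteq> {}" "\<And>j. j \<in> J \<Longrightarrow> integrable T (\<lambda>t. f j t)"
    and "\<And>j t. j \<in> J \<Longrightarrow> t \<in> space T \<Longrightarrow> 0 \<le> f j t"
  shows "integrable T (\<lambda>t. MAX j\<in>J. f j t)"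
proof (rule Bochner_Integration.integrable_bound)
  show "integrable T (\<lambda>t. \<Sum>j\<in>J. f j t)" using assms by auto
  show "(\<lambda>t. MAX j\<in>J. f j t) \<in> borel_measurable T"
    using assms by (intro borel_measurable_Max) auto
  show "AE t in T. norm (MAX j\<in>J. f j t) \<le> norm (\<Sum>j\<in>J. f j t)"
  proof (rule AE_I2)
    fix t assume t: "t \<in> space T"
    have "(MAX j\<in>J. f j t) \<in> (\<lambda>j. f j t) ` J"
      using assms(1,2) by (intro Max_in) auto
    then obtain j where j: "j \<in> J" "(MAX j\<in>J. f j t) = f j t" by auto
    have "f j t \<le> (\<Sum>j\<in>J. f j t)"
      using assms t j(1) by (intro member_le_sum) auto
    then show "norm (MAX j\<in>J. f j t) \<le> norm (\<Sum>j\<in>J. f j t)"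
      using j assms(4)[OF j(1) t] by simp
  qed
qed

text \<open>The joint distribution function of finitely many suprema is the max-stable one with the
  spectral functions \<open>f j\<close>.\<close>

lemma prob_frechet_sup_le:
  fixes f :: "'i \<Rightarrow> 'a \<Rightarrow> real"
  assumes T: "prob_space T" and \<alpha>: "0 < \<alpha>" and J: "finite J" "J \<noteq> {}"
    and f: "\<And>j. j \<in> J \<Longrightarrow> integrable T (\<lambda>t. f j t powr \<alpha>)"
    and f0: "\<And>j t. j \<in> J \<Longrightarrow> t \<in> space T \<Longrightarrow> 0 \<le> f j t"
    and x: "\<And>j. j \<in> J \<Longrightarrow> 0 < x j"
  shows "measure (poisson_space T)
      {\<omega> \<in> space (poisson_space T). \<forall>j\<in>J. frechet_sup \<alpha> (f j) \<omega> \<le> ennreal (x j)} =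
    exp (- (\<integral>t. (MAX j\<in>J. f j t powr \<alpha> / x j powr \<alpha>) \<partial>T))"
proof -
  let ?g = "\<lambda>t. MAX j\<in>J. f j t powr \<alpha> / x j powr \<alpha>"
  have "integrable T ?g"
    using J f by (intro integrable_Max) auto
  moreover have "0 \<le> ?g t" for t
    using J by (auto simp: Max_ge_iff)
  ultimately have "measure (poisson_space T)
    {\<omega> \<in> space (poisson_space T). \<forall>k. \<forall>i<fst (\<omega> k).
       ?g (snd (snd (\<omega> k) i)) \<le> real k + fst (snd (\<omega> k) i)} = exp (- (\<integral>t. ?g t \<partial>T))"
    by (intro poisson_void T)
  moreover have "{\<omega> \<in> space (poisson_space T). \<forall>k. \<forall>i<fst (\<omega> k).
       ?g (snd (snd (\<omega> k) i)) \<le> real k + fst (snd (\<omega> k) i)} =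
     {\<omega> \<in> space (poisson_space T). \<forall>j\<in>J. frechet_sup \<alpha> (f j) \<omega> \<le> ennreal (x j)}"
    using J \<alpha> f0 x by (auto simp: frechet_sup_le_iff_powr)
  ultimately show ?thesis by simp
qed

lemma prob_frechet_sup_le_single:
  assumes T: "prob_space T" and \<alpha>: "0 < \<alpha>" 
    and f: "integrable T (\<lambda>t. f t powr \<alpha>)"
    and f0: "\<And>t. t \<in> space T \<Longrightarrow> 0 \<le> f t"
    and x: "0 < x"
  shows "measure (poisson_space T)
      {\<omega> \<in> space (poisson_space T). frechet_sup \<alpha> f \<omega> \<le> ennreal x} =
    exp (- (\<integral>t. f t powr \<alpha> \<partial>T) * x powr (- \<alpha>))"
  using prob_frechet_sup_le[OF T \<alpha>, of "{()}" "\<lambda>_. f" "\<lambda>_. x"] f f0 x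
  by (simp add: powr_minus_divide)

lemma AE_frechet_sup_finite:
  assumes T: "prob_space T" and \<alpha>: "0 < \<alpha>" 
    and [measurable]: "f \<in> borel_measurable T"
    and f: "integrable T (\<lambda>t. f t powr \<alpha>)"
    and f0: "\<And>t. t \<in> space T \<Longrightarrow> 0 \<le> f t"
  shows "AE \<omega> in poisson_space T. frechet_sup \<alpha> f \<omega> < \<top>"
proof -
  interpret P: prob_space "poisson_space T" by (rule prob_space_poisson_space[OF T])
  let ?E = "{\<omega> \<in> space (poisson_space T). frechet_sup \<alpha> f \<omega> < \<top>}"
  have "exp (- (\<integral>t. f t powr \<alpha> \<partial>T) * x powr (- \<alpha>)) \<le> P.prob ?E" if "0 < x" for x
  proof -
    have "P.prob {\<omega> \<in> space (poisson_space T). frechet_sup \<alpha> f \<omega> \<le> ennreal x} \<le> P.prob ?E"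
      by (intro P.finite_measure_mono) (auto intro: le_less_trans)
    then show ?thesis by (simp only: prob_frechet_sup_le_single[OF T \<alpha> f f0 that])
  qed
  then have "eventually (\<lambda>x. exp (- (\<integral>t. f t powr \<alpha> \<partial>T) * x powr (- \<alpha>)) \<le> P.prob ?E) at_top"
    by (intro eventually_mono[OF eventually_gt_at_top[of 0]])
  moreover have "((\<lambda>x. exp (- (\<integral>t. f t powr \<alpha> \<partial>T) * x powr (- \<alpha>))) \<longlongrightarrow>
      exp (- (\<integral>t. f t powr \<alpha> \<partial>T) * 0)) at_top"
    using \<alpha> by (intro tendsto_intros tendsto_neg_powr filterlim_ident) auto
  ultimately have "1 \<le> P.prob ?E"
    using tendsto_upperbound[of _ _ at_top "P.prob ?E"] by force
  then have "P.prob ?E = 1" using P.prob_le_1[of ?E] by linarith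
  then show ?thesis by (subst (asm) P.prob_eq_1) auto
qed

text \<open>The supremum has a Frechet distribution whose scale is the \<open>\<alpha>\<close>-norm of \<open>f\<close>
  (the point mass at 0 if that norm is 0). Hence it is
  distributed as \<open>(c / E) powr (1 / \<alpha>)\<close>, where \<open>c\<close> is the integral of \<open>f powr \<alpha>\<close> and \<open>E\<close> is
  standard exponential, and its moments are powers of \<open>c\<close> times values of the Gamma function.\<close>

lemma frechet_sup_moment:
  assumes T: "prob_space T" and \<alpha>: "0 < \<alpha>" 
    and [measurable]: "f \<in> borel_measurable T"
    and f: "integrable T (\<lambda>t. f t powr \<alpha>)"
    and f0: "\<And>t. t \<in> space T \<Longrightarrow> 0 \<le> f t"
    and p: "0 < p" "p < \<alpha>"
  shows "(\<integral>\<^sup>+ \<omega>. ennreal (enn2real (frechet_sup \<alpha> f \<omega>) powr p) \<partial>poisson_space T) =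
    ennreal ((\<integral>t. f t powr \<alpha> \<partial>T) powr (p / \<alpha>) * Gamma (1 - p / \<alpha>))"
proof -
  interpret P: prob_space "poisson_space T" by (rule prob_space_poisson_space[OF T])
  define E where "E = density lborel (\<lambda>t. ennreal (exponential_density 1 t))"
  interpret E: prob_space E unfolding E_def by (rule prob_space_exponential_density) simp
  have sets_E [measurable_cong, simp]: "sets E = sets borel" by (simp add: E_def)
  have space_E [simp]: "space E = UNIV" by (simp add: E_def)
  define c where "c = (\<integral>t. f t powr \<alpha> \<partial>T)"
  have c: "0 \<le> c" unfolding c_def by (intro integral_nonneg_AE) auto
  define R where "R = (\<lambda>\<omega>. enn2real (frechet_sup \<alpha> f \<omega>))"
  define Y where "Y = (\<lambda>t::real. c powr (1 / \<alpha>) * \<bar>t\<bar> powr (- 1 / \<alpha>))"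
  have [measurable]: "R \<in> borel_measurable (poisson_space T)" unfolding R_def by measurable
  have [measurable]: "Y \<in> borel_measurable borel" unfolding Y_def by measurable
  let ?A = "distr (poisson_space T) borel R" and ?B = "distr E borel Y"
  interpret A: real_distribution ?A by (rule P.real_distribution_distr) measurable
  interpret B: real_distribution ?B by (rule E.real_distribution_distr) measurable
  have AE_finite: "AE \<omega> in poisson_space T. frechet_sup \<alpha> f \<omega> < \<top>"
    by (rule AE_frechet_sup_finite[OF T \<alpha> assms(3) f]) (rule f0)
  have posA: "cdf ?A x = exp (- c * x powr (- \<alpha>))" if x: "0 < x" for x
  proof -
    have "cdf ?A x = P.prob {\<omega> \<in> space (poisson_space T). R \<omega> \<le> x}"
      unfolding cdf_def by (subst measure_distr) (auto intro!: arg_cong[where f = P.prob])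
    also have "\<dots> = P.prob {\<omega> \<in> space (poisson_space T). frechet_sup \<alpha> f \<omega> \<le> ennreal x}"
    proof (rule P.prob_eq_AE)
      show "AE \<omega> in poisson_space T. R \<omega> \<le> x \<longleftrightarrow> frechet_sup \<alpha> f \<omega> \<le> ennreal x"
        using AE_finite
      proof eventually_elim
        case (elim \<omega>)
        then show ?case using x unfolding R_def
          by (cases "frechet_sup \<alpha> f \<omega>") auto
      qed
    qed measurable
    finally show ?thesis by (simp only: prob_frechet_sup_le_single[OF T \<alpha> f f0 x] c_def)
  qed
  have E_pos: "AE t in E. 0 < t"
  proof -
    have "AE t in lborel. t \<noteq> (0::real)" by (rule AE_lborel_singleton)
    then show ?thesis unfolding E_def
      by (subst AE_density) (auto simp: exponential_density_def elim!: eventually_mono)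
  qed
  have posB: "cdf ?B x = exp (- c * x powr (- \<alpha>))" if x: "0 < x" for x
  proof -
    let ?a = "c * x powr (- \<alpha>)"
    have "AE t in lborel. t \<noteq> ?a" by (rule AE_lborel_singleton)
    then have ne: "AE t in E. t \<noteq> ?a" unfolding E_def
      by (subst AE_density) (auto elim!: eventually_mono)
    have "cdf ?B x = E.prob {t \<in> space E. Y t \<le> x}"
      unfolding cdf_def by (subst measure_distr) (auto intro!: arg_cong[where f = E.prob])
    also have "\<dots> = E.prob {t \<in> space E. ?a < t}"
    proof (rule E.prob_eq_AE)
      show "AE t in E. Y t \<le> x \<longleftrightarrow> ?a < t" using E_pos ne
      proof eventually_elim
        case (elim t)
        have "Y t \<le> x \<longleftrightarrow> (c powr (1 / \<alpha>)) powr \<alpha> / x powr \<alpha> \<le> t"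
          using powr_inverse_mult_le_iff[of t "c powr (1 / \<alpha>)" x \<alpha>] elim x \<alpha>
          by (simp add: Y_def mult_ac)
        also have "(c powr (1 / \<alpha>)) powr \<alpha> / x powr \<alpha> = ?a"
          using c \<alpha> by (simp add: powr_powr powr_minus_divide)
        finally show ?case using elim by auto
      qed
    qed measurable
    also have "\<dots> = exp (- ?a * 1)"
    proof (rule E.exponential_distributedD_gt)
      show "distributed E lborel (\<lambda>t. t) (exponential_density 1)"
        unfolding distributed_def E_def by (auto simp: distr_id2 exponential_density_def)
    qed (use c in auto)
    finally show ?thesis by simp
  qed
  have "?A = ?B"
  proof (rule cdf_unique)
    show "cdf ?A = cdf ?B"
    proof
      fix x :: real
      consider "x < 0" | "x = 0" | "0 < x" by linarith
      then show "cdf ?A x = cdf ?B x"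
      proof cases
        case 1
        have "0 \<le> R \<omega>" "0 \<le> Y t" for \<omega> t by (simp_all add: R_def Y_def)
        then have "\<not> R \<omega> \<le> x" "\<not> Y t \<le> x" for \<omega> t
          using 1 by (meson not_le order_less_le_trans)+
        then have "R -` {..x} \<inter> space (poisson_space T) = {}" "Y -` {..x} \<inter> space E = {}"
          by blast+
        then show ?thesis unfolding cdf_def by (simp add: measure_distr)
      next
        case 2
        \<comment> \<open>Right-continuity settles the value at 0, where the Frechet formula is not available.\<close>
        have "(cdf ?A \<longlongrightarrow> cdf ?A 0) (at_right 0)" "(cdf ?B \<longlongrightarrow> cdf ?B 0) (at_right 0)"
          using A.cdf_is_right_cont[of 0] B.cdf_is_right_cont[of 0] by (auto simp: continuous_within)
        moreover have "eventually (\<lambda>x. cdf ?A x = cdf ?B x) (at_right 0)"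
          by (auto simp: eventually_at_right_field posA posB intro: exI[of _ 1])
        ultimately have "(cdf ?B \<longlongrightarrow> cdf ?A 0) (at_right 0)"
          by (blast intro: Lim_transform_eventually)
        then have "cdf ?A 0 = cdf ?B 0"
          using \<open>(cdf ?B \<longlongrightarrow> cdf ?B 0) (at_right 0)\<close>
          by (rule tendsto_unique[OF trivial_limit_at_right_real])
        then show ?thesis using 2 by simp
      qed (simp add: posA posB)
    qed
  qed (unfold_locales)
  have "(\<integral>\<^sup>+ \<omega>. ennreal (R \<omega> powr p) \<partial>poisson_space T) = (\<integral>\<^sup>+ y. ennreal (y powr p) \<partial>?A)"
    by (subst nn_integral_distr) auto
  also have "\<dots> = (\<integral>\<^sup>+ t. ennreal (Y t powr p) \<partial>E)"
    unfolding \<open>?A = ?B\<close> by (subst nn_integral_distr) auto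
  also have "\<dots> = (\<integral>\<^sup>+ t. ennreal (exponential_density 1 t) * ennreal (Y t powr p) \<partial>lborel)"
    unfolding E_def by (subst nn_integral_density) auto
  also have "\<dots> = (\<integral>\<^sup>+ t. ennreal (c powr (p / \<alpha>)) *
      ennreal (indicator {0..} t * t powr ((1 - p / \<alpha>) - 1) / exp t) \<partial>lborel)"
  proof (rule nn_integral_cong)
    fix t :: real
    have "exponential_density 1 t * Y t powr p =
        c powr (p / \<alpha>) * (indicator {0..} t * t powr ((1 - p / \<alpha>) - 1) / exp t)"
    proof (cases "0 \<le> t")
      case True
      then have "Y t powr p = c powr (p / \<alpha>) * t powr (- (p / \<alpha>))"
        using c by (simp add: Y_def powr_mult powr_powr)
      then show ?thesis
        using True by (simp add: exponential_density_def exp_minus divide_inverse)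
    qed (simp add: exponential_density_def)
    moreover have "0 \<le> exponential_density 1 t" by (simp add: exponential_density_def)
    ultimately show "ennreal (exponential_density 1 t) * ennreal (Y t powr p) =
        ennreal (c powr (p / \<alpha>)) *
        ennreal (indicator {0..} t * t powr ((1 - p / \<alpha>) - 1) / exp t)"
      by (subst (1 2) ennreal_mult'[symmetric]) auto
  qed
  also have "\<dots> = ennreal (c powr (p / \<alpha>)) * ennreal (Gamma (1 - p / \<alpha>))"
    using p \<alpha> by (subst nn_integral_cmult) (auto simp: Gamma_conv_nn_integral_real)
  finally show ?thesis
    using p \<alpha> by (simp add: R_def c_def ennreal_mult Gamma_real_nonneg)
qed

lemma frechet_sup_upper:
  assumes "i < fst (\<omega> k)"
  shows "ennreal ((real k + fst (snd (\<omega> k) i)) powr (- 1 / \<alpha>) * f (snd (snd (\<omega> k) i))) \<le> frechet_sup \<alpha> f \<omega>"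
  unfolding frechet_sup_def by (rule SUP_upper2[of k], simp, rule SUP_upper2[of i]) (use assms in auto)

section \<open>Max-stable vectors and their coupling\<close>

lemma frechet_sup_add_le:
  assumes \<omega>: "\<omega> \<in> space (poisson_space T)"
    and "\<And>t. t \<in> space T \<Longrightarrow> 0 \<le> g t" "\<And>t. t \<in> space T \<Longrightarrow> 0 \<le> h t"
    and "\<And>t. t \<in> space T \<Longrightarrow> f t \<le> g t + h t"
  shows "frechet_sup \<alpha> f \<omega> \<le> frechet_sup \<alpha> g \<omega> + frechet_sup \<alpha> h \<omega>"
  unfolding frechet_sup_def[of \<alpha> f]
proof (intro SUP_least)
  fix k i
  let ?v = "(real k + fst (snd (\<omega> k) i)) powr (- 1 / \<alpha>)" and ?t = "snd (snd (\<omega> k) i)"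
  have t: "?t \<in> space T" using space_poisson_spaceD[OF \<omega>] by auto
  show "(if i < fst (\<omega> k) then ennreal (?v * f ?t) else 0) \<le> frechet_sup \<alpha> g \<omega> + frechet_sup \<alpha> h \<omega>"
  proof (cases "i < fst (\<omega> k)")
    case True
    have "ennreal (?v * f ?t) \<le> ennreal (?v * (g ?t + h ?t))"
      using assms(4)[OF t] by (intro ennreal_leI mult_left_mono) auto
    also have "\<dots> = ennreal (?v * g ?t) + ennreal (?v * h ?t)"
      using assms(2,3) t by (simp add: distrib_left)
    also have "\<dots> \<le> frechet_sup \<alpha> g \<omega> + frechet_sup \<alpha> h \<omega>"
      using True by (intro add_mono frechet_sup_upper)
    finally show ?thesis using True by simp
  qed simp
qed

text \<open>Suprema over the same process differ by at most the supremum for the difference of the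
  spectral functions. This is the point of using one process for both vectors.\<close>

lemma frechet_sup_diff_le:
  assumes \<omega>: "\<omega> \<in> space (poisson_space T)"
    and pos: "\<And>t. t \<in> space T \<Longrightarrow> 0 \<le> f t" "\<And>t. t \<in> space T \<Longrightarrow> 0 \<le> g t"
    and h: "\<And>t. t \<in> space T \<Longrightarrow> \<bar>f t - g t\<bar> \<le> h t"
    and fin: "frechet_sup \<alpha> f \<omega> < \<top>" "frechet_sup \<alpha> g \<omega> < \<top>" "frechet_sup \<alpha> h \<omega> < \<top>"
  shows "\<bar>enn2real (frechet_sup \<alpha> f \<omega>) - enn2real (frechet_sup \<alpha> g \<omega>)\<bar> \<le> enn2real (frechet_sup \<alpha> h \<omega>)"
proof -
  have h0: "0 \<le> h t" if "t \<in> space T" for t using h[OF that] by linarith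
  have 1: "frechet_sup \<alpha> f \<omega> \<le> frechet_sup \<alpha> g \<omega> + frechet_sup \<alpha> h \<omega>"
    using pos h h0 by (intro frechet_sup_add_le[OF \<omega>]) force+
  have 2: "frechet_sup \<alpha> g \<omega> \<le> frechet_sup \<alpha> f \<omega> + frechet_sup \<alpha> h \<omega>"
    using pos h h0 by (intro frechet_sup_add_le[OF \<omega>]) force+
  obtain a b c where "frechet_sup \<alpha> f \<omega> = ennreal a" "frechet_sup \<alpha> g \<omega> = ennreal b"
    "frechet_sup \<alpha> h \<omega> = ennreal c" "0 \<le> a" "0 \<le> b" "0 \<le> c"
    using fin by (metis ennreal_cases less_top)
  then show ?thesis using 1 2 by (simp add: ennreal_plus[symmetric] del: ennreal_plus)
qed

text \<open>The random vector whose coordinates are the suprema for the coordinates of \<open>Z\<close>. An infinite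
  supremum, which has probability 0 for a de Haan representer \<open>Z\<close>, is replaced by 0.\<close>

definition max_stable_vector ::
    "real \<Rightarrow> ('a \<Rightarrow> real ^ 'n) \<Rightarrow> (nat \<Rightarrow> nat \<times> (nat \<Rightarrow> real \<times> 'a)) \<Rightarrow> real ^ 'n" where
  "max_stable_vector \<alpha> Z \<omega> = (\<chi> j. enn2real (frechet_sup \<alpha> (\<lambda>t. Z t $ j) \<omega>))"

lemma de_haan_representerD:
  fixes F :: "real ^ 'n \<Rightarrow> real"
  assumes "de_haan_representer \<alpha> F M Z"
  shows "prob_space M" "Z \<in> borel_measurable M"
    "\<And>\<omega> j. \<omega> \<in> space M \<Longrightarrow> 0 \<le> Z \<omega> $ j"
    "\<And>j. integrable M (\<lambda>\<omega>. Z \<omega> $ j powr \<alpha>)" "\<And>j. (\<integral>\<omega>. Z \<omega> $ j powr \<alpha> \<partial>M) = 1"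
proof -
  show Z [measurable]: "Z \<in> borel_measurable M" and "prob_space M"
    "\<And>\<omega> j. \<omega> \<in> space M \<Longrightarrow> 0 \<le> Z \<omega> $ j"
    using assms by (auto simp: de_haan_representer_def)
  fix j
  have 1: "(\<integral>\<^sup>+ \<omega>. ennreal (Z \<omega> $ j powr \<alpha>) \<partial>M) = 1"
    using assms by (auto simp: de_haan_representer_def)
  then show "integrable M (\<lambda>\<omega>. Z \<omega> $ j powr \<alpha>)"
    by (intro integrableI_nonneg) auto
  show "(\<integral>\<omega>. Z \<omega> $ j powr \<alpha> \<partial>M) = 1"
    using 1 by (subst integral_eq_nn_integral) auto
qed

lemma measurable_max_stable_vector:
  fixes Z :: "'a \<Rightarrow> real ^ 'n"
  assumes [measurable]: "Z \<in> borel_measurable M"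
  shows "max_stable_vector \<alpha> Z \<in> borel_measurable (poisson_space M)"
  unfolding max_stable_vector_def[abs_def] by (intro borel_measurable_vec_lambda) measurable

lemma AE_max_stable_vector_finite:
  fixes Z :: "'a \<Rightarrow> real ^ 'n"
  assumes Z: "de_haan_representer \<alpha> F M Z" and \<alpha>: "0 < \<alpha>"
  shows "AE \<omega> in poisson_space M. \<forall>j. frechet_sup \<alpha> (\<lambda>t. Z t $ j) \<omega> < \<top>"
proof -
  note [measurable] = de_haan_representerD(2)[OF Z]
  have "AE \<omega> in poisson_space M. frechet_sup \<alpha> (\<lambda>t. Z t $ j) \<omega> < \<top>" for j
    using de_haan_representerD[OF Z] by (intro AE_frechet_sup_finite \<alpha>) auto
  then show ?thesis by (simp add: AE_all_countable)
qed

text \<open>The spectral construction of a max-stable law from a de Haan representer. If some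
  coordinate of \<open>x\<close> is not positive, both sides are 0: that coordinate of the vector stays below \<open>e\<close>
  with a probability that tends to 0 as \<open>e > 0\<close> decreases to 0.\<close>

lemma has_distribution_function_max_stable_vector:
  fixes F :: "real ^ 'n \<Rightarrow> real"
  assumes Z: "de_haan_representer \<alpha> F M Z" and \<alpha>: "0 < \<alpha>"
  shows "has_distribution_function (distr (poisson_space M) borel (max_stable_vector \<alpha> Z)) F"
proof -
  note D = de_haan_representerD[OF Z]
  note [measurable] = D(2) measurable_max_stable_vector[OF D(2)]
  interpret P: prob_space "poisson_space M" by (rule prob_space_poisson_space[OF D(1)])
  let ?X = "max_stable_vector \<alpha> Z" and ?R = "\<lambda>j. frechet_sup \<alpha> (\<lambda>t. Z t $ j)"
  note fin = AE_max_stable_vector_finite[OF Z \<alpha>]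
  have Xj: "?X \<omega> $ j = enn2real (?R j \<omega>)" for \<omega> j by (simp add: max_stable_vector_def)
  have [measurable]: "{..x} \<in> sets borel" for x :: "real ^ 'n"
  proof -
    have "{..x} = {y \<in> space borel. \<forall>j. y $ j \<le> x $ j}" by (auto simp: less_eq_vec_def)
    also have "\<dots> \<in> sets borel" by measurable
    finally show ?thesis .
  qed
  have "measure (distr (poisson_space M) borel ?X) {..x} = F x" for x
  proof -
    have mX: "measure (distr (poisson_space M) borel ?X) {..x} =
        P.prob {\<omega> \<in> space (poisson_space M). \<forall>j. ?X \<omega> $ j \<le> x $ j}"
      by (subst measure_distr) (auto simp: less_eq_vec_def intro!: arg_cong[where f = P.prob])
    show ?thesis
    proof (cases "\<forall>j. 0 < x $ j")
      case True
      have "P.prob {\<omega> \<in> space (poisson_space M). \<forall>j. ?X \<omega> $ j \<le> x $ j} =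
          P.prob {\<omega> \<in> space (poisson_space M). \<forall>j\<in>UNIV. ?R j \<omega> \<le> ennreal (x $ j)}"
      proof (rule P.prob_eq_AE)
        show "AE \<omega> in poisson_space M. (\<forall>j. ?X \<omega> $ j \<le> x $ j) \<longleftrightarrow> (\<forall>j\<in>UNIV. ?R j \<omega> \<le> ennreal (x $ j))"
          using fin
        proof eventually_elim
          case (elim \<omega>)
          have "?X \<omega> $ j \<le> x $ j \<longleftrightarrow> ?R j \<omega> \<le> ennreal (x $ j)" for j
            using elim[rule_format, of j] True[rule_format, of j] unfolding Xj
            by (cases "?R j \<omega>") auto
          then show ?case by simp
        qed
      qed measurable
      also have "\<dots> = exp (- (\<integral>t. (MAX j. Z t $ j powr \<alpha> / x $ j powr \<alpha>) \<partial>M))"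
        using D True by (intro prob_frechet_sup_le \<alpha>) auto
      also have "\<dots> = F x" using Z True by (auto simp: de_haan_representer_def)
      finally show ?thesis unfolding mX .
    next
      case False
      then obtain j where j: "x $ j \<le> 0" by (auto simp: not_less)
      let ?q = "P.prob {\<omega> \<in> space (poisson_space M). \<forall>j. ?X \<omega> $ j \<le> x $ j}"
      have "?q \<le> exp (- (e powr (- \<alpha>)))" if e: "0 < e" for e
      proof -
        have "?q \<le> P.prob {\<omega> \<in> space (poisson_space M). ?R j \<omega> \<le> ennreal e}"
        proof (rule P.finite_measure_mono_AE)
          show "AE \<omega> in poisson_space M. \<omega> \<in> {\<omega> \<in> space (poisson_space M). \<forall>j. ?X \<omega> $ j \<le> x $ j} \<longrightarrow>
              \<omega> \<in> {\<omega> \<in> space (poisson_space M). ?R j \<omega> \<le> ennreal e}"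
            using fin
          proof eventually_elim
            case (elim \<omega>)
            have "?R j \<omega> \<le> ennreal e" if "?X \<omega> $ j \<le> x $ j"
              using elim[rule_format, of j] that j e unfolding Xj
              by (cases "?R j \<omega>") (auto intro: ennreal_leI)
            then show ?case by auto
          qed
        qed measurable
        also have "\<dots> = exp (- (\<integral>t. Z t $ j powr \<alpha> \<partial>M) * e powr (- \<alpha>))"
          using D e by (intro prob_frechet_sup_le_single \<alpha>) auto
        finally show ?thesis by (simp add: D)
      qed
      note bound = this
      have "?q \<le> exp (- y)" if y: "0 < y" for y
        \<comment> \<open>This choice of the level makes the bound equal to \<open>exp (- y)\<close>, and \<open>y\<close> is arbitrary.\<close>
        using bound[of "y powr (- 1 / \<alpha>)"] y \<alpha> by (simp add: powr_powr)
      then have "eventually (\<lambda>y. ?q \<le> exp (- y)) at_top"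
        by (intro eventually_mono[OF eventually_gt_at_top[of 0]])
      moreover have "((\<lambda>y :: real. exp (- y)) \<longlongrightarrow> 0) at_top"
        by (intro filterlim_compose[OF exp_at_bot] filterlim_uminus_at_bot_at_top)
      ultimately have "?q \<le> 0"
        by (intro tendsto_lowerbound[where F = at_top]) auto
      then have "?q = 0" by (simp add: measure_le_0_iff)
      moreover have "F x = 0" using Z j by (auto simp: de_haan_representer_def)
      ultimately show ?thesis unfolding mX by simp
    qed
  qed
  moreover have "prob_space (distr (poisson_space M) borel ?X)"
    by (rule P.prob_space_distr) measurable
  ultimately show ?thesis by (simp only: has_distribution_function_def sets_distr simp_thms)
qed

lemma law_of_max_stable_vector:
  assumes "de_haan_representer \<alpha> F M Z" "0 < \<alpha>"
  shows "law_of F = distr (poisson_space M) borel (max_stable_vector \<alpha> Z)"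
  using law_of_eq has_distribution_function_max_stable_vector assms by blast

lemma wasserstein_max_stable_le:
  fixes Z1 Z2 :: "'a \<Rightarrow> real ^ 'n" and F1 F2 :: "real ^ 'n \<Rightarrow> real"
  assumes Z1: "de_haan_representer \<alpha> F1 M Z1" and Z2: "de_haan_representer \<alpha> F2 M Z2"
    and \<alpha>: "0 < \<alpha>" and N [measurable]: "N \<in> borel_measurable borel"
  shows "wasserstein p N (law_of F1) (law_of F2) \<le> ennreal_powr (\<integral>\<^sup>+ \<omega>.
      ennreal (N (max_stable_vector \<alpha> Z1 \<omega> - max_stable_vector \<alpha> Z2 \<omega>) powr p) \<partial>poisson_space M) (1 / p)"
proof -
  let ?X = "max_stable_vector \<alpha> Z1" and ?Y = "max_stable_vector \<alpha> Z2"
  note [measurable] = measurable_max_stable_vector[OF de_haan_representerD(2)[OF Z1]]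
    measurable_max_stable_vector[OF de_haan_representerD(2)[OF Z2]]
  let ?\<pi> = "distr (poisson_space M) (borel \<Otimes>\<^sub>M borel) (\<lambda>\<omega>. (?X \<omega>, ?Y \<omega>))"
  have "?\<pi> \<in> couplings (law_of F1) (law_of F2)"
    unfolding couplings_def law_of_max_stable_vector[OF Z1 \<alpha>] law_of_max_stable_vector[OF Z2 \<alpha>]
    by (auto intro!: sets_pair_measure_cong simp: distr_distr comp_def cong: distr_cong)
  then have "wasserstein p N (law_of F1) (law_of F2) \<le>
      ennreal_powr (\<integral>\<^sup>+ (x, y). ennreal (N (x - y) powr p) \<partial>?\<pi>) (1 / p)"
    unfolding wasserstein_def by (rule INF_lower)
  also have "(\<integral>\<^sup>+ (x, y). ennreal (N (x - y) powr p) \<partial>?\<pi>) =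
      (\<integral>\<^sup>+ \<omega>. ennreal (N (?X \<omega> - ?Y \<omega>) powr p) \<partial>poisson_space M)"
    by (subst nn_integral_distr) auto
  finally show ?thesis .
qed

text \<open>The two estimates for arbitrary representers on a common probability space. The distance is bounded
  by that of the coupled vectors, which is dominated by one Frechet variable with spectral function
  \<open>infnorm (Z1 t - Z2 t)\<close> for the maximum norm, and by the sum of one such variable per coordinate,
  to which Minkowski's inequality applies, for the \<open>l1norm\<close>.\<close>

lemma wasserstein_infnorm_le:
  fixes Z1 Z2 :: "'a \<Rightarrow> real ^ 'n" and F1 F2 :: "real ^ 'n \<Rightarrow> real"
  assumes Z1: "de_haan_representer \<alpha> F1 M Z1" and Z2: "de_haan_representer \<alpha> F2 M Z2"
    and p: "0 < p" "p < \<alpha>"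
  shows "wasserstein p infnorm (law_of F1) (law_of F2) \<le> ennreal (Gamma (1 - p / \<alpha>) powr (1 / p)) *
    ennreal_powr (\<integral>\<^sup>+ t. ennreal (infnorm (Z1 t - Z2 t) powr \<alpha>) \<partial>M) (1 / \<alpha>)"
proof -
  have \<alpha>: "0 < \<alpha>" using p by simp
  note D1 = de_haan_representerD[OF Z1] and D2 = de_haan_representerD[OF Z2]
  note [measurable] = D1(2) D2(2)
  let ?h = "\<lambda>t. infnorm (Z1 t - Z2 t)"
  let ?I = "\<integral>\<^sup>+ t. ennreal (?h t powr \<alpha>) \<partial>M"
  have G: "0 < Gamma (1 - p / \<alpha>)" using p \<alpha> by (intro Gamma_real_pos) simp
  show ?thesis
  proof (cases "?I = \<top>")
    case True
    then show ?thesis using G by (simp add: ennreal_powr_def ennreal_mult_top)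
  next
    case False
    let ?c = "\<integral>t. ?h t powr \<alpha> \<partial>M"
    have h: "integrable M (\<lambda>t. ?h t powr \<alpha>)"
      using False by (intro integrableI_nonneg) (auto simp: less_top)
    have I: "?I = ennreal ?c" by (rule nn_integral_eq_integral[OF h]) simp
    have c: "0 \<le> ?c" by (rule integral_nonneg_AE) simp
    have fin: "AE \<omega> in poisson_space M. frechet_sup \<alpha> ?h \<omega> < \<top>"
      by (rule AE_frechet_sup_finite[OF D1(1) \<alpha> _ h]) (auto simp: infnorm_pos_le)
    have "wasserstein p infnorm (law_of F1) (law_of F2) \<le> ennreal_powr (\<integral>\<^sup>+ \<omega>.
      ennreal (infnorm (max_stable_vector \<alpha> Z1 \<omega> - max_stable_vector \<alpha> Z2 \<omega>) powr p)
        \<partial>poisson_space M) (1 / p)"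
      by (rule wasserstein_max_stable_le[OF Z1 Z2 \<alpha>]) measurable
    also have "\<dots> \<le> ennreal_powr (\<integral>\<^sup>+ \<omega>. ennreal (enn2real (frechet_sup \<alpha> ?h \<omega>) powr p)
        \<partial>poisson_space M) (1 / p)"
    proof (intro ennreal_powr_mono nn_integral_mono_AE)
      show "AE \<omega> in poisson_space M.
        ennreal (infnorm (max_stable_vector \<alpha> Z1 \<omega> - max_stable_vector \<alpha> Z2 \<omega>) powr p) \<le>
        ennreal (enn2real (frechet_sup \<alpha> ?h \<omega>) powr p)"
        using fin AE_max_stable_vector_finite[OF Z1 \<alpha>] AE_max_stable_vector_finite[OF Z2 \<alpha>] AE_space
      proof eventually_elim
        case (elim \<omega>)
        have "\<bar>(max_stable_vector \<alpha> Z1 \<omega> - max_stable_vector \<alpha> Z2 \<omega>) $ j\<bar> \<le>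
            enn2real (frechet_sup \<alpha> ?h \<omega>)" for j
          unfolding max_stable_vector_def vector_minus_component vec_lambda_beta
        proof (rule frechet_sup_diff_le[OF elim(4)])
          show "\<bar>Z1 t $ j - Z2 t $ j\<bar> \<le> ?h t" for t
            using component_le_infnorm_cart[of "Z1 t - Z2 t" j] by simp
        qed (use elim D1(3) D2(3) in auto)
        then show ?case
          using p by (intro ennreal_leI powr_mono2 infnorm_le_cart infnorm_pos_le) auto
      qed
    qed (use p in simp)
    also have "(\<integral>\<^sup>+ \<omega>. ennreal (enn2real (frechet_sup \<alpha> ?h \<omega>) powr p) \<partial>poisson_space M) =
        ennreal (?c powr (p / \<alpha>) * Gamma (1 - p / \<alpha>))"
      by (rule frechet_sup_moment[OF D1(1) \<alpha> _ h]) (use p in \<open>auto simp: infnorm_pos_le\<close>)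
    also have "ennreal_powr \<dots> (1 / p) = ennreal (Gamma (1 - p / \<alpha>) powr (1 / p)) * ennreal_powr ?I (1 / \<alpha>)"
      unfolding I using p G c
      by (simp add: ennreal_powr_ennreal ennreal_mult[symmetric] powr_mult powr_powr mult.commute)
    finally show ?thesis .
  qed
qed

lemma wasserstein_l1norm_le:
  fixes Z1 Z2 :: "'a \<Rightarrow> real ^ 'n" and F1 F2 :: "real ^ 'n \<Rightarrow> real"
  assumes Z1: "de_haan_representer \<alpha> F1 M Z1" and Z2: "de_haan_representer \<alpha> F2 M Z2"
    and p: "1 \<le> p" "p < \<alpha>"
  shows "wasserstein p l1norm (law_of F1) (law_of F2) \<le> ennreal (Gamma (1 - p / \<alpha>) powr (1 / p)) *
    (\<Sum>j\<in>UNIV. ennreal_powr (\<integral>\<^sup>+ t. ennreal (\<bar>Z1 t $ j - Z2 t $ j\<bar> powr \<alpha>) \<partial>M) (1 / \<alpha>))"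
proof -
  have \<alpha>: "0 < \<alpha>" using p by simp
  note D1 = de_haan_representerD[OF Z1] and D2 = de_haan_representerD[OF Z2]
  note [measurable] = D1(2) D2(2)
  let ?h = "\<lambda>j t. \<bar>Z1 t $ j - Z2 t $ j\<bar>"
  let ?I = "\<lambda>j. \<integral>\<^sup>+ t. ennreal (?h j t powr \<alpha>) \<partial>M"
  let ?G = "Gamma (1 - p / \<alpha>)"
  have G: "0 < ?G" using p \<alpha> by (intro Gamma_real_pos) simp
  show ?thesis
  proof (cases "\<exists>j. ?I j = \<top>")
    case True
    then obtain j where "?I j = \<top>" by blast
    then have top: "(\<Sum>j\<in>UNIV. ennreal_powr (?I j) (1 / \<alpha>)) = \<top>"
      using member_le_sum[of j UNIV "\<lambda>j. ennreal_powr (?I j) (1 / \<alpha>)"]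
      by (simp add: ennreal_powr_def top_unique)
    show ?thesis unfolding top using G by (simp add: ennreal_mult_top)
  next
    case False
    let ?c = "\<lambda>j. \<integral>t. ?h j t powr \<alpha> \<partial>M"
    let ?R = "\<lambda>j \<omega>. enn2real (frechet_sup \<alpha> (?h j) \<omega>)"
    define A where "A j = ?G powr (1 / p) * ?c j powr (1 / \<alpha>)" for j
    have h: "integrable M (\<lambda>t. ?h j t powr \<alpha>)" for j
      using False by (intro integrableI_nonneg) (auto simp: less_top)
    have I: "?I j = ennreal (?c j)" for j by (rule nn_integral_eq_integral[OF h]) simp
    have c: "0 \<le> ?c j" for j by (rule integral_nonneg_AE) simp
    have A0: "0 \<le> A j" for j by (simp add: A_def)
    have fin: "AE \<omega> in poisson_space M. \<forall>j. frechet_sup \<alpha> (?h j) \<omega> < \<top>"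
      by (subst AE_all_countable) (auto intro!: AE_frechet_sup_finite[OF D1(1) \<alpha>] h)
    have mom: "(\<integral>\<^sup>+ \<omega>. ennreal (?R j \<omega> powr p) \<partial>poisson_space M) \<le> ennreal (A j powr p)" for j
    proof -
      have "(\<integral>\<^sup>+ \<omega>. ennreal (?R j \<omega> powr p) \<partial>poisson_space M) = ennreal (?c j powr (p / \<alpha>) * ?G)"
        by (rule frechet_sup_moment[OF D1(1) \<alpha> _ h]) (use p in auto)
      also have "?c j powr (p / \<alpha>) * ?G = A j powr p"
        unfolding A_def using p G c by (simp add: powr_mult powr_powr mult.commute)
      finally show ?thesis by simp
    qed
    have "wasserstein p l1norm (law_of F1) (law_of F2) \<le> ennreal_powr (\<integral>\<^sup>+ \<omega>.
      ennreal (l1norm (max_stable_vector \<alpha> Z1 \<omega> - max_stable_vector \<alpha> Z2 \<omega>) powr p)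
        \<partial>poisson_space M) (1 / p)"
      by (rule wasserstein_max_stable_le[OF Z1 Z2 \<alpha>]) measurable
    also have "\<dots> \<le> ennreal_powr (\<integral>\<^sup>+ \<omega>. ennreal ((\<Sum>j\<in>UNIV. ?R j \<omega>) powr p)
        \<partial>poisson_space M) (1 / p)"
    proof (intro ennreal_powr_mono nn_integral_mono_AE)
      show "AE \<omega> in poisson_space M.
        ennreal (l1norm (max_stable_vector \<alpha> Z1 \<omega> - max_stable_vector \<alpha> Z2 \<omega>) powr p) \<le>
        ennreal ((\<Sum>j\<in>UNIV. ?R j \<omega>) powr p)"
        using fin AE_max_stable_vector_finite[OF Z1 \<alpha>] AE_max_stable_vector_finite[OF Z2 \<alpha>] AE_space
      proof eventually_elim
        case (elim \<omega>)
        have "\<bar>(max_stable_vector \<alpha> Z1 \<omega> - max_stable_vector \<alpha> Z2 \<omega>) $ j\<bar> \<le> ?R j \<omega>" for j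
          unfolding max_stable_vector_def vector_minus_component vec_lambda_beta
          by (rule frechet_sup_diff_le[OF elim(4)]) (use elim D1(3) D2(3) in auto)
        then show ?case
          unfolding l1norm_def using p by (intro ennreal_leI powr_mono2 sum_mono sum_nonneg) auto
      qed
    qed (use p in simp)
    also have "\<dots> \<le> ennreal_powr (ennreal ((\<Sum>j\<in>UNIV. A j) powr p)) (1 / p)"
      using p A0 mom by (intro ennreal_powr_mono nn_integral_powr_sum_le) auto
    also have "\<dots> = ennreal (\<Sum>j\<in>UNIV. A j)"
      using p A0 by (simp add: ennreal_powr_ennreal powr_powr sum_nonneg)
    also have "\<dots> = ennreal (?G powr (1 / p)) * (\<Sum>j\<in>UNIV. ennreal_powr (?I j) (1 / \<alpha>))"
      unfolding I A_def using c
      by (simp add: ennreal_powr_ennreal sum_distrib_left[symmetric] ennreal_mult sum_nonneg)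
    finally show ?thesis .
  qed
qed

section \<open>Angular measures and canonical representers\<close>

lemma space_angular_measure:
  "angular_measure \<alpha> F H \<Longrightarrow> space H = sphere_pow \<alpha>"
  unfolding angular_measure_def
  by (metis (no_types, lifting) sets_eq_imp_space_eq space_restrict_space space_borel Int_UNIV_right)

lemma tau_powr:
  assumes "0 < \<alpha>" shows "tau \<alpha> z powr \<alpha> = (\<Sum>j\<in>UNIV. (z $ j) powr \<alpha>)"
  using assms by (simp add: tau_def powr_powr sum_nonneg)

text \<open>Change of variables: the angular measure is the image, under normalisation, of the law of the
  representer \<open>Z\<close> weighted by \<open>tau \<alpha> (Z \<omega>) powr \<alpha>\<close>. As the maximum of the
  \<open>s $ j powr \<alpha> / x $ j powr \<alpha>\<close> is homogeneous of order \<open>\<alpha>\<close> in \<open>s\<close>, the weight undoes the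
  normalisation.\<close>

lemma angular_measure_exponent:
  fixes F :: "real ^ 'n \<Rightarrow> real"
  assumes H: "angular_measure \<alpha> F H" and \<alpha>: "0 < \<alpha>" and x: "\<And>j. 0 < x $ j"
  shows "F x = exp (- enn2real (\<integral>\<^sup>+ s. ennreal (MAX j. s $ j powr \<alpha> / x $ j powr \<alpha>) \<partial>H))"
proof -
  from H obtain M :: "(real ^ 'n) measure" and Z where Z: "de_haan_representer \<alpha> F M Z"
    and sets_H: "sets H = sets (restrict_space borel (sphere_pow \<alpha>))"
    and em: "\<And>B. B \<in> sets H \<Longrightarrow> emeasure H B = (\<integral>\<^sup>+ \<omega>. ennreal (tau \<alpha> (Z \<omega>) powr \<alpha>) *
              indicator B ((1 / tau \<alpha> (Z \<omega>)) *\<^sub>R Z \<omega>) \<partial>M)"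
    unfolding angular_measure_def by blast
  note D = de_haan_representerD[OF Z]
  note [measurable] = D(2)
  note [measurable_cong] = sets_H
  have [measurable]: "(tau \<alpha> :: real ^ 'n \<Rightarrow> real) \<in> borel_measurable borel"
    unfolding tau_def[abs_def] by measurable
  let ?\<tau> = "\<lambda>\<omega>. tau \<alpha> (Z \<omega>)"
  let ?g = "\<lambda>s. MAX j. s $ j powr \<alpha> / x $ j powr \<alpha>"
  \<comment> \<open>An arbitrary point of the sphere, the value of the normalised vector where \<open>Z\<close> vanishes; the weight
    is 0 there.\<close>
  define s0 :: "real ^ 'n" where "s0 = axis undefined 1"
  have s0: "s0 \<in> sphere_pow \<alpha>"
  proof -
    have "(\<Sum>j\<in>UNIV. (s0 $ j) powr \<alpha>) = (\<Sum>j\<in>UNIV. if j = (undefined :: 'n) then 1 else 0)"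
      by (rule sum.cong) (auto simp: s0_def axis_def)
    then show ?thesis by (auto simp: sphere_pow_def s0_def axis_def)
  qed
  define \<Theta> where "\<Theta> \<omega> = (if 0 < ?\<tau> \<omega> then (1 / ?\<tau> \<omega>) *\<^sub>R Z \<omega> else s0)" for \<omega>
  have \<Theta>_sphere: "\<Theta> \<omega> \<in> sphere_pow \<alpha>" if "\<omega> \<in> space M" for \<omega>
  proof (cases "0 < ?\<tau> \<omega>")
    case True
    have "(\<Sum>j\<in>UNIV. (Z \<omega> $ j / ?\<tau> \<omega>) powr \<alpha>) = (\<Sum>j\<in>UNIV. Z \<omega> $ j powr \<alpha>) / ?\<tau> \<omega> powr \<alpha>"
      using D(3)[OF that] True by (simp add: powr_divide sum_divide_distrib)
    also have "\<dots> = 1"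
      using True unfolding tau_powr[OF \<alpha>, symmetric] by simp
    finally show ?thesis
      using True D(3)[OF that] by (simp add: sphere_pow_def \<Theta>_def)
  qed (simp add: \<Theta>_def s0)
  have [measurable]: "\<Theta> \<in> measurable M H"
    unfolding measurable_cong_sets[OF refl sets_H]
  proof (rule measurable_restrict_space2)
    show "\<Theta> \<in> space M \<rightarrow> sphere_pow \<alpha>" using \<Theta>_sphere by auto
    show "\<Theta> \<in> borel_measurable M" unfolding \<Theta>_def[abs_def] by measurable
  qed
  have g [measurable]: "?g \<in> borel_measurable borel"
    by (intro borel_measurable_Max) auto
  have gH [measurable]: "?g \<in> borel_measurable H"
    unfolding measurable_cong_sets[OF sets_H refl] by (intro measurable_restrict_space1) measurable
  let ?M = "density M (\<lambda>\<omega>. ennreal (?\<tau> \<omega> powr \<alpha>))"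
  have \<tau>0: "0 \<le> ?\<tau> \<omega>" for \<omega> by (simp add: tau_def)
  have "H = distr ?M H \<Theta>"
  proof (rule measure_eqI)
    fix B assume B [measurable]: "B \<in> sets H"
    have "emeasure (distr ?M H \<Theta>) B = (\<integral>\<^sup>+ \<omega>. indicator B (\<Theta> \<omega>) \<partial>?M)"
      by (subst nn_integral_indicator[symmetric], simp, subst nn_integral_distr) auto
    also have "\<dots> = (\<integral>\<^sup>+ \<omega>. ennreal (?\<tau> \<omega> powr \<alpha>) * indicator B (\<Theta> \<omega>) \<partial>M)"
      by (subst nn_integral_density) auto
    also have "\<dots> = emeasure H B"
      unfolding em[OF B]
    proof (rule nn_integral_cong)
      show "ennreal (?\<tau> \<omega> powr \<alpha>) * indicator B (\<Theta> \<omega>) =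
          ennreal (?\<tau> \<omega> powr \<alpha>) * indicator B ((1 / ?\<tau> \<omega>) *\<^sub>R Z \<omega>)" for \<omega>
        using \<tau>0[of \<omega>] by (cases "?\<tau> \<omega> = 0") (auto simp: \<Theta>_def)
    qed
    finally show "emeasure H B = emeasure (distr ?M H \<Theta>) B" ..
  qed simp
  then have "(\<integral>\<^sup>+ s. ennreal (?g s) \<partial>H) = (\<integral>\<^sup>+ s. ennreal (?g s) \<partial>distr ?M H \<Theta>)"
    by (rule arg_cong)
  also have "\<dots> = (\<integral>\<^sup>+ \<omega>. ennreal (?g (\<Theta> \<omega>)) \<partial>?M)"
    by (rule nn_integral_distr) measurable
  also have "\<dots> = (\<integral>\<^sup>+ \<omega>. ennreal (?\<tau> \<omega> powr \<alpha>) * ennreal (?g (\<Theta> \<omega>)) \<partial>M)"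
    by (rule nn_integral_density) measurable
  also have "\<dots> = (\<integral>\<^sup>+ \<omega>. ennreal (?g (Z \<omega>)) \<partial>M)"
  proof (rule nn_integral_cong)
    fix \<omega> assume \<omega>: "\<omega> \<in> space M"
    have "?\<tau> \<omega> powr \<alpha> * ?g (\<Theta> \<omega>) = (MAX j. ?\<tau> \<omega> powr \<alpha> * (\<Theta> \<omega> $ j powr \<alpha> / x $ j powr \<alpha>))"
      by (rule Max_cmult[symmetric]) simp
    also have "(\<lambda>j. ?\<tau> \<omega> powr \<alpha> * (\<Theta> \<omega> $ j powr \<alpha> / x $ j powr \<alpha>)) = (\<lambda>j. Z \<omega> $ j powr \<alpha> / x $ j powr \<alpha>)"
    proof
      fix j
      show "?\<tau> \<omega> powr \<alpha> * (\<Theta> \<omega> $ j powr \<alpha> / x $ j powr \<alpha>) = Z \<omega> $ j powr \<alpha> / x $ j powr \<alpha>"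
      proof (cases "0 < ?\<tau> \<omega>")
        case True
        then show ?thesis using D(3)[OF \<omega>] by (simp add: \<Theta>_def powr_divide)
      next
        case False
        then have "?\<tau> \<omega> = 0" using \<tau>0[of \<omega>] by simp
        then have "(\<Sum>j\<in>UNIV. Z \<omega> $ j powr \<alpha>) = 0" unfolding tau_powr[OF \<alpha>, symmetric] by simp
        then have "Z \<omega> $ j powr \<alpha> = 0" by (subst (asm) sum_nonneg_eq_0_iff) auto
        then show ?thesis using \<open>?\<tau> \<omega> = 0\<close> by simp
      qed
    qed
    finally show "ennreal (?\<tau> \<omega> powr \<alpha>) * ennreal (?g (\<Theta> \<omega>)) = ennreal (?g (Z \<omega>))"
      by (simp add: ennreal_mult'[symmetric])
  qed
  finally have "(\<integral>\<^sup>+ s. ennreal (?g s) \<partial>H) = (\<integral>\<^sup>+ \<omega>. ennreal (?g (Z \<omega>)) \<partial>M)" .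
  moreover have "(\<integral>\<omega>. ?g (Z \<omega>) \<partial>M) = enn2real (\<integral>\<^sup>+ \<omega>. ennreal (?g (Z \<omega>)) \<partial>M)"
    by (rule integral_eq_nn_integral) (auto simp: Max_ge_iff)
  moreover have "F x = exp (- (\<integral>\<omega>. ?g (Z \<omega>) \<partial>M))"
    using Z x by (auto simp: de_haan_representer_def)
  ultimately show ?thesis by simp
qed

lemma angular_measure_zero:
  fixes F :: "real ^ 'n \<Rightarrow> real"
  assumes "angular_measure \<alpha> F H" "x $ j \<le> 0" shows "F x = 0"
  using assms unfolding angular_measure_def de_haan_representer_def by blast

text \<open>On the sphere the \<open>s $ j powr \<alpha>\<close> add up to 1, and each of them has integral 1.\<close>

lemma emeasure_angular_measure_sphere:
  fixes F :: "real ^ 'n \<Rightarrow> real"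
  assumes H: "angular_measure \<alpha> F H"
    and norm: "\<And>j. (\<integral>\<^sup>+ s. ennreal ((s $ j) powr \<alpha>) \<partial>H) = 1"
  shows "emeasure H (sphere_pow \<alpha>) = of_nat CARD('n)"
proof -
  have sets_H: "sets H = sets (restrict_space borel (sphere_pow \<alpha>))"
    using H by (simp add: angular_measure_def)
  have [measurable]: "(\<lambda>s. s $ j) \<in> borel_measurable H" for j
    unfolding measurable_cong_sets[OF sets_H refl] by (intro measurable_restrict_space1) measurable
  have "emeasure H (sphere_pow \<alpha>) = (\<integral>\<^sup>+ s. 1 \<partial>H)"
    by (simp add: space_angular_measure[OF H])
  also have "\<dots> = (\<integral>\<^sup>+ s. (\<Sum>j\<in>UNIV. ennreal ((s $ j) powr \<alpha>)) \<partial>H)"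
    by (intro nn_integral_cong) (simp add: space_angular_measure[OF H] sphere_pow_def)
  also have "\<dots> = (\<Sum>j\<in>(UNIV :: 'n set). 1)"
    by (subst nn_integral_sum) (auto simp: norm)
  finally show ?thesis by simp
qed

text \<open>The factor \<open>CARD('n) powr (1 / \<alpha>)\<close> compensates, in \<open>\<alpha>\<close>-homogeneous integrands, for the division of
  the angular measure by \<open>CARD('n)\<close>.\<close>

lemma de_haan_representer_angular:
  fixes F :: "real ^ 'n \<Rightarrow> real" and S :: "'a \<Rightarrow> real ^ 'n"
  assumes H: "angular_measure \<alpha> F H" and \<alpha>: "0 < \<alpha>"
    and norm: "\<And>j. (\<integral>\<^sup>+ s. ennreal ((s $ j) powr \<alpha>) \<partial>H) = 1"
    and S: "random_element_with_law M S (scale_measure (1 / of_nat CARD('n)) H)"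
  shows "de_haan_representer \<alpha> F M (\<lambda>\<omega>. (real CARD('n) powr (1 / \<alpha>)) *\<^sub>R S \<omega>)"
proof -
  let ?d = "real CARD('n)" and ?P = "scale_measure (1 / of_nat CARD('n)) H"
  let ?Z = "\<lambda>\<omega>. (?d powr (1 / \<alpha>)) *\<^sub>R S \<omega>"
  have M: "prob_space M" and SP: "S \<in> measurable M ?P" and law: "distr M ?P S = ?P"
    using S by (auto simp: random_element_with_law_def)
  have sets_H: "sets H = sets (restrict_space borel (sphere_pow \<alpha>))"
    using H by (simp add: angular_measure_def)
  have S_sphere: "S \<omega> \<in> sphere_pow \<alpha>" if "\<omega> \<in> space M" for \<omega>
    using measurable_space[OF SP that] by (simp add: space_scale_measure space_angular_measure[OF H])
  have id: "(\<lambda>s. s) \<in> measurable ?P borel"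
    unfolding measurable_cong_sets[OF trans[OF sets_scale_measure sets_H] refl]
    by (intro measurable_restrict_space1) simp
  have [measurable]: "S \<in> borel_measurable M" using measurable_compose[OF SP id] .
  have int: "(\<integral>\<^sup>+ \<omega>. ennreal (?d * g (S \<omega>)) \<partial>M) = (\<integral>\<^sup>+ s. ennreal (g s) \<partial>H)"
    if [measurable]: "g \<in> borel_measurable borel" for g :: "real ^ 'n \<Rightarrow> real"
  proof -
    have gP [measurable]: "g \<in> borel_measurable ?P" using measurable_compose[OF id that] .
    then have gH [measurable]: "g \<in> borel_measurable H"
      by (simp add: measurable_cong_sets[OF sets_scale_measure refl])
    have "(\<integral>\<^sup>+ \<omega>. ennreal (?d * g (S \<omega>)) \<partial>M) = (\<integral>\<^sup>+ s. ennreal (?d * g s) \<partial>distr M ?P S)"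
      by (rule nn_integral_distr[OF SP, symmetric]) measurable
    also have "\<dots> = (\<integral>\<^sup>+ s. of_nat CARD('n) * ennreal (g s) \<partial>?P)"
      unfolding law by (simp add: ennreal_mult' ennreal_of_nat_eq_real_of_nat)
    also have "\<dots> = (1 / of_nat CARD('n)) * (of_nat CARD('n) * (\<integral>\<^sup>+ s. ennreal (g s) \<partial>H))"
      by (subst nn_integral_scale_measure) (auto simp: nn_integral_cmult)
    also have "\<dots> = (\<integral>\<^sup>+ s. ennreal (g s) \<partial>H)"
      using inverse_of_nat_mult_ennreal[of "CARD('n)"] by (simp add: mult.assoc[symmetric])
    finally show ?thesis .
  qed
  have pw: "?Z \<omega> $ j powr \<alpha> = ?d * S \<omega> $ j powr \<alpha>" if "\<omega> \<in> space M" for \<omega> j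
    using S_sphere[OF that] \<alpha> by (simp add: sphere_pow_def powr_mult powr_powr)
  show ?thesis
    unfolding de_haan_representer_def
  proof (intro conjI allI ballI impI)
    show "0 \<le> ?Z \<omega> $ j" if "\<omega> \<in> space M" for \<omega> j
      using S_sphere[OF that] by (simp add: sphere_pow_def)
    show "(\<integral>\<^sup>+ \<omega>. ennreal (?Z \<omega> $ j powr \<alpha>) \<partial>M) = 1" for j
    proof -
      have "(\<integral>\<^sup>+ \<omega>. ennreal (?Z \<omega> $ j powr \<alpha>) \<partial>M) = (\<integral>\<^sup>+ \<omega>. ennreal (?d * S \<omega> $ j powr \<alpha>) \<partial>M)"
        by (intro nn_integral_cong) (simp only: pw)
      then show ?thesis using int[of "\<lambda>s. s $ j powr \<alpha>"] norm[of j] by simp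
    qed
    show "AE \<omega> in M. 0 < (MAX j. ?Z \<omega> $ j)"
    proof (rule AE_I2)
      fix \<omega> assume "\<omega> \<in> space M"
      from S_sphere[OF this] have s: "\<And>j. 0 \<le> S \<omega> $ j" "(\<Sum>j\<in>UNIV. S \<omega> $ j powr \<alpha>) = 1"
        by (auto simp: sphere_pow_def)
      have "\<exists>j. S \<omega> $ j \<noteq> 0"
      proof (rule ccontr)
        assume "\<nexists>j. S \<omega> $ j \<noteq> 0"
        then show False using s(2) by simp
      qed
      then obtain j where "0 < S \<omega> $ j" using s(1) by (metis less_eq_real_def)
      then show "0 < (MAX j. ?Z \<omega> $ j)"
        by (subst Max_gr_iff) (auto intro!: exI[of _ j])
    qed
    show "F x = exp (- (\<integral>\<omega>. (MAX j. ?Z \<omega> $ j powr \<alpha> / x $ j powr \<alpha>) \<partial>M))" if x: "\<forall>j. 0 < x $ j" for x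
    proof -
      let ?g = "\<lambda>s :: real ^ 'n. MAX j. s $ j powr \<alpha> / x $ j powr \<alpha>"
      have [measurable]: "?g \<in> borel_measurable borel"
        by (intro borel_measurable_Max) auto
      have "(\<integral>\<omega>. ?g (?Z \<omega>) \<partial>M) = (\<integral>\<omega>. ?d * ?g (S \<omega>) \<partial>M)"
      proof (rule Bochner_Integration.integral_cong)
        fix \<omega> assume "\<omega> \<in> space M"
        then have "?g (?Z \<omega>) = (MAX j. ?d * (S \<omega> $ j powr \<alpha> / x $ j powr \<alpha>))"
          by (simp only: pw times_divide_eq_right)
        then show "?g (?Z \<omega>) = ?d * ?g (S \<omega>)" by (simp only: Max_cmult of_nat_0_le_iff)
      qed simp
      also have "\<dots> = enn2real (\<integral>\<^sup>+ \<omega>. ennreal (?d * ?g (S \<omega>)) \<partial>M)"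
        by (rule integral_eq_nn_integral) (auto simp: Max_ge_iff intro!: mult_nonneg_nonneg)
      also have "\<dots> = enn2real (\<integral>\<^sup>+ s. ennreal (?g s) \<partial>H)"
        by (subst int) auto
      finally show ?thesis
        using angular_measure_exponent[OF H \<alpha>] x by simp
    qed
    show "F x = 0" if "\<exists>j. x $ j \<le> 0" for x
      using that angular_measure_zero[OF H] by blast
  qed (use M in auto)
qed

lemma couplingsD:
  assumes "\<pi> \<in> couplings \<mu> \<nu>" "prob_space \<mu>"
  shows "random_element_with_law \<pi> fst \<mu>" "random_element_with_law \<pi> snd \<nu>"
proof -
  have sets: "sets \<pi> = sets (\<mu> \<Otimes>\<^sub>M \<nu>)" and law: "distr \<pi> \<mu> fst = \<mu>" "distr \<pi> \<nu> snd = \<nu>"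
    using assms by (auto simp: couplings_def)
  have m: "fst \<in> measurable \<pi> \<mu>" "snd \<in> measurable \<pi> \<nu>"
    by (simp_all add: measurable_cong_sets[OF sets refl])
  have "prob_space \<pi>"
    using assms(2) law(1) prob_space_distrD[OF m(1)] by simp
  then show "random_element_with_law \<pi> fst \<mu>" "random_element_with_law \<pi> snd \<nu>"
    using m law by (auto simp: random_element_with_law_def)
qed

section \<open>The Wasserstein bounds\<close>

theorem mainTheorem4:
  fixes \<alpha> p :: real
    and F :: "nat \<Rightarrow> real ^ 'n \<Rightarrow> real"
    and H P :: "nat \<Rightarrow> (real ^ 'n) measure"
  assumes \<alpha>: "\<alpha> > 1"
    and F_max_stable: "\<And>k. k \<in> {1, 2} \<Longrightarrow> max_stable (F k)"
    and F_margins: "\<And>k. k \<in> {1, 2} \<Longrightarrow> unit_frechet_margins \<alpha> (F k)"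
    and H_angular: "\<And>k. k \<in> {1, 2} \<Longrightarrow> angular_measure \<alpha> (F k) (H k)"
    and H_normalised: "\<And>k j. k \<in> {1, 2} \<Longrightarrow> (\<integral>\<^sup>+ s. ennreal ((s $ j) powr \<alpha>) \<partial>H k) = 1"
    and P_eq: "\<And>k. k \<in> {1, 2} \<Longrightarrow> P k = scale_measure (1 / of_nat CARD('n)) (H k)"
  shows "(\<forall>k\<in>{1, 2}.
            emeasure (H k) (sphere_pow \<alpha>) = of_nat CARD('n) \<and>
            prob_space (P k) \<and>
            (\<forall>(M :: 'a measure) S. random_element_with_law M S (P k) \<longrightarrow>
               de_haan_representer \<alpha> (F k) M (\<lambda>\<omega>. (real CARD('n) powr (1 / \<alpha>)) *\<^sub>R S \<omega>) \<and>
               canonical_de_haan_representer \<alpha> (H k) M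
                 (\<lambda>\<omega>. (real CARD('n) powr (1 / \<alpha>)) *\<^sub>R S \<omega>))) \<and>
         (1 \<le> p \<and> p < \<alpha> \<longrightarrow>
            wasserstein p infnorm (law_of (F 1)) (law_of (F 2))
              \<le> ennreal (real CARD('n) powr (1 / \<alpha>) * Gamma (1 - p / \<alpha>) powr (1 / p))
                  * wasserstein \<alpha> infnorm (P 1) (P 2) \<and>
            wasserstein p l1norm (law_of (F 1)) (law_of (F 2))
              \<le> ennreal (real CARD('n) powr (1 / \<alpha>) * Gamma (1 - p / \<alpha>) powr (1 / p))
                  * (INF \<pi>\<in>couplings (P 1) (P 2). \<Sum>j\<in>UNIV.
                       ennreal_powr (\<integral>\<^sup>+ (s, t). ennreal (\<bar>s $ j - t $ j\<bar> powr \<alpha>) \<partial>\<pi>) (1 / \<alpha>)))"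
proof -
  let ?d = "real CARD('n)"
  let ?b = "?d powr (1 / \<alpha>)" and ?G = "Gamma (1 - p / \<alpha>) powr (1 / p)"
  have \<alpha>0: "0 < \<alpha>" using \<alpha> by simp
  have mass: "emeasure (H k) (sphere_pow \<alpha>) = of_nat CARD('n)" if "k \<in> {1, 2}" for k
    using emeasure_angular_measure_sphere[OF H_angular H_normalised] that by blast
  have spaceH: "space (H k) = sphere_pow \<alpha>" if "k \<in> {1, 2}" for k
    using space_angular_measure[OF H_angular[OF that]] .
  have prob: "prob_space (P k)" if "k \<in> {1, 2}" for k
  proof
    show "emeasure (P k) (space (P k)) = 1"
      using inverse_of_nat_mult_ennreal[of "CARD('n)"]
      by (simp add: P_eq[OF that] space_scale_measure spaceH[OF that] mass[OF that])
  qed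
  have repr: "de_haan_representer \<alpha> (F k) M (\<lambda>\<omega>. ?b *\<^sub>R S \<omega>)"
    if k: "k \<in> {1, 2}" and S: "random_element_with_law M S (P k)" for k and M :: "'a measure" and S
    using de_haan_representer_angular[OF H_angular[OF k] \<alpha>0 H_normalised[OF k]] S
    unfolding P_eq[OF k] by blast
  have canonical: "canonical_de_haan_representer \<alpha> (H k) M (\<lambda>\<omega>. ?b *\<^sub>R S \<omega>)"
    if k: "k \<in> {1, 2}" and S: "random_element_with_law M S (P k)" for k and M :: "'a measure" and S
    using S unfolding canonical_de_haan_representer_def P_eq[OF k] spaceH[OF k] mass[OF k]
    by (auto simp: measure_def mass[OF k] intro!: exI[of _ S])
  have reprs: "de_haan_representer \<alpha> (F 1) \<pi> (\<lambda>\<omega>. ?b *\<^sub>R fst \<omega>)"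
      "de_haan_representer \<alpha> (F 2) \<pi> (\<lambda>\<omega>. ?b *\<^sub>R snd \<omega>)"
    if "\<pi> \<in> couplings (P 1) (P 2)" for \<pi>
  proof -
    have k: "1 \<in> {1, 2 :: nat}" "2 \<in> {1, 2 :: nat}" by simp_all
    note law = couplingsD[OF that prob[OF k(1)]]
    show "de_haan_representer \<alpha> (F 1) \<pi> (\<lambda>\<omega>. ?b *\<^sub>R fst \<omega>)"
      by (rule de_haan_representer_angular[OF H_angular[OF k(1)] \<alpha>0 H_normalised[OF k(1)]
            law(1)[unfolded P_eq[OF k(1)]]])
    show "de_haan_representer \<alpha> (F 2) \<pi> (\<lambda>\<omega>. ?b *\<^sub>R snd \<omega>)"
      by (rule de_haan_representer_angular[OF H_angular[OF k(2)] \<alpha>0 H_normalised[OF k(2)]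
            law(2)[unfolded P_eq[OF k(2)]]])
  qed
  have bG: "ennreal (?b * ?G) = ennreal ?G * ennreal ?b"
    by (simp add: ennreal_mult mult.commute)
  \<comment> \<open>The canonical representers carry the factor \<open>?b\<close>, which homogeneity takes out of the integral.\<close>
  have scale: "ennreal_powr (\<integral>\<^sup>+ \<omega>. ennreal (N (?b *\<^sub>R fst \<omega> - ?b *\<^sub>R snd \<omega>) powr \<alpha>) \<partial>\<pi>) (1 / \<alpha>) \<le>
      ennreal ?b * ennreal_powr (\<integral>\<^sup>+ (s, t). ennreal (N (s - t) powr \<alpha>) \<partial>\<pi>) (1 / \<alpha>)"
    if \<pi>: "\<pi> \<in> couplings (P 1) (P 2)" and N [measurable]: "N \<in> borel_measurable borel"
      and hom: "\<And>x. N (?b *\<^sub>R x) = ?b * N x" and N0: "\<And>x. 0 \<le> N x"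
    for \<pi> and N :: "real ^ 'n \<Rightarrow> real"
  proof -
    have b: "?b \<noteq> 0" by simp
    have "(\<lambda>\<omega>. (1 / ?b) *\<^sub>R (?b *\<^sub>R fst \<omega>)) \<in> borel_measurable \<pi>"
        "(\<lambda>\<omega>. (1 / ?b) *\<^sub>R (?b *\<^sub>R snd \<omega>)) \<in> borel_measurable \<pi>"
      using reprs[OF \<pi>, THEN de_haan_representerD(2)] by measurable
    then have [measurable]: "fst \<in> borel_measurable \<pi>" "snd \<in> borel_measurable \<pi>"
      using b by simp_all
    have "(\<integral>\<^sup>+ \<omega>. ennreal (N (?b *\<^sub>R fst \<omega> - ?b *\<^sub>R snd \<omega>) powr \<alpha>) \<partial>\<pi>) =
        (\<integral>\<^sup>+ \<omega>. ennreal ?d * ennreal (N (fst \<omega> - snd \<omega>) powr \<alpha>) \<partial>\<pi>)"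
    proof (rule nn_integral_cong)
      show "ennreal (N (?b *\<^sub>R fst \<omega> - ?b *\<^sub>R snd \<omega>) powr \<alpha>) =
          ennreal ?d * ennreal (N (fst \<omega> - snd \<omega>) powr \<alpha>)" for \<omega>
        using \<alpha>0 N0 unfolding scaleR_diff_right[symmetric] hom
        by (simp add: powr_mult powr_powr ennreal_mult)
    qed
    also have "\<dots> = ennreal ?d * (\<integral>\<^sup>+ (s, t). ennreal (N (s - t) powr \<alpha>) \<partial>\<pi>)"
      by (subst nn_integral_cmult) (auto simp: case_prod_unfold)
    finally show ?thesis
      using ennreal_powr_mult_const[of ?d _ "1 / \<alpha>"] by simp
  qed
  have "wasserstein p infnorm (law_of (F 1)) (law_of (F 2)) \<le>
      ennreal (?b * ?G) * wasserstein \<alpha> infnorm (P 1) (P 2)" if p: "1 \<le> p" "p < \<alpha>"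
    unfolding wasserstein_def[of \<alpha>]
  proof (rule ennreal_mult_le_INF)
    have "0 < Gamma (1 - p / \<alpha>)" using p \<alpha>0 by (intro Gamma_real_pos) simp
    then show "0 < ?b * ?G" by simp
    fix \<pi> assume \<pi>: "\<pi> \<in> couplings (P 1) (P 2)"
    have "wasserstein p infnorm (law_of (F 1)) (law_of (F 2)) \<le> ennreal ?G * ennreal_powr
        (\<integral>\<^sup>+ \<omega>. ennreal (infnorm (?b *\<^sub>R fst \<omega> - ?b *\<^sub>R snd \<omega>) powr \<alpha>) \<partial>\<pi>) (1 / \<alpha>)"
      using p by (intro wasserstein_infnorm_le reprs[OF \<pi>]) auto
    also have "\<dots> \<le> ennreal ?G * (ennreal ?b *
        ennreal_powr (\<integral>\<^sup>+ (s, t). ennreal (infnorm (s - t) powr \<alpha>) \<partial>\<pi>) (1 / \<alpha>))"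
      by (intro mult_left_mono scale[OF \<pi>]) (simp_all add: infnorm_mul infnorm_pos_le)
    finally show "wasserstein p infnorm (law_of (F 1)) (law_of (F 2)) \<le> ennreal (?b * ?G) *
        ennreal_powr (\<integral>\<^sup>+ (s, t). ennreal (infnorm (s - t) powr \<alpha>) \<partial>\<pi>) (1 / \<alpha>)"
      by (simp only: bG mult.assoc)
  qed
  moreover have "wasserstein p l1norm (law_of (F 1)) (law_of (F 2)) \<le>
      ennreal (?b * ?G) * (INF \<pi>\<in>couplings (P 1) (P 2). \<Sum>j\<in>UNIV.
        ennreal_powr (\<integral>\<^sup>+ (s, t). ennreal (\<bar>s $ j - t $ j\<bar> powr \<alpha>) \<partial>\<pi>) (1 / \<alpha>))"
    if p: "1 \<le> p" "p < \<alpha>"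
  proof (rule ennreal_mult_le_INF)
    have "0 < Gamma (1 - p / \<alpha>)" using p \<alpha>0 by (intro Gamma_real_pos) simp
    then show "0 < ?b * ?G" by simp
    fix \<pi> assume \<pi>: "\<pi> \<in> couplings (P 1) (P 2)"
    have "wasserstein p l1norm (law_of (F 1)) (law_of (F 2)) \<le> ennreal ?G * (\<Sum>j\<in>UNIV. ennreal_powr
        (\<integral>\<^sup>+ \<omega>. ennreal (\<bar>(?b *\<^sub>R fst \<omega>) $ j - (?b *\<^sub>R snd \<omega>) $ j\<bar> powr \<alpha>) \<partial>\<pi>) (1 / \<alpha>))"
      using p by (intro wasserstein_l1norm_le reprs[OF \<pi>]) auto
    also have "\<dots> \<le> ennreal ?G * (\<Sum>j\<in>UNIV. ennreal ?b *
        ennreal_powr (\<integral>\<^sup>+ (s, t). ennreal (\<bar>s $ j - t $ j\<bar> powr \<alpha>) \<partial>\<pi>) (1 / \<alpha>))"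
    proof (intro mult_left_mono sum_mono)
      fix j
      show "ennreal_powr (\<integral>\<^sup>+ \<omega>. ennreal (\<bar>(?b *\<^sub>R fst \<omega>) $ j - (?b *\<^sub>R snd \<omega>) $ j\<bar> powr \<alpha>) \<partial>\<pi>) (1 / \<alpha>)
          \<le> ennreal ?b * ennreal_powr (\<integral>\<^sup>+ (s, t). ennreal (\<bar>s $ j - t $ j\<bar> powr \<alpha>) \<partial>\<pi>) (1 / \<alpha>)"
        using scale[OF \<pi>, of "\<lambda>x. \<bar>x $ j\<bar>"] by (simp add: abs_mult)
    qed simp
    finally show "wasserstein p l1norm (law_of (F 1)) (law_of (F 2)) \<le> ennreal (?b * ?G) *
        (\<Sum>j\<in>UNIV. ennreal_powr (\<integral>\<^sup>+ (s, t). ennreal (\<bar>s $ j - t $ j\<bar> powr \<alpha>) \<partial>\<pi>) (1 / \<alpha>))"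
      by (simp only: bG mult.assoc sum_distrib_left)
  qed
  ultimately show ?thesis
    by (intro conjI ballI allI impI) (simp_all only: mass prob repr canonical)
qed

end
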